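(* There is a universal constant $C$ such that the following holds. Let $D$ be any (admissible) concave delay function, let $f$ be a piece-wise linear function with exponentially decreasing slopes satisfying $f(x)\le D(x)\le 2f(x)$ for all $x\ge 0$, and let BPSLA be the Bipartite-Single-Location-Algorithm run with the counters defined by $f$. Then for every instance of Single Location Concave MBPMD, the total delay cost (measured with $D$) of the matching produced by BPSLA is at most $C$ times the cost of an optimal offline solution.
   Context: Admissible delay function: $D:[0,\infty)\to[0,\infty)$ with $D(0)=0$, concave, continuous, monotonically increasing, with all one-sided derivatives positive and bounded, and $\lim_{t\to\infty}D(t)=\infty$. Single Location Concave MBPMD: finitely many requests arrive over time at a single location; request $r$ arrives at time $a(r)\ge 0$ and has a polarity, positive or negative; the numbers of positive and negative requests are equal. At any time an algorithm may irrevocably match an arrived unmatched positive request with an arrived unmatched negative request; all requests must eventually be matched. If $r$ is matched at time $m(r)\ge a(r)$ it incurs delay cost $D(m(r)-a(r))$; the cost of a solution is $\sum_r D(m(r)-a(r))$. An online algorithm's decisions at time $t$ depend only on requests arrived by time $t$. The optimal offline solution minimizes the cost knowing the whole instance. Piece-wise linear function with exponentially decreasing slopes: $f$ is continuous with $f(0)=0$, and there are $0=x_0<x_1<x_2<\dots$ such that on the $k$-th piece $[x_{k-1},x_k)$ ($k=1,2,\dots$) $f$ is linear with slope $\alpha_k>0$, where $\alpha_k\ge 2\alpha_{k+1}$; either there are finitely many pieces $k=1,\dots,d$ with $x_d=\infty$, or infinitely many with $x_k\to\infty$. Put $y_k=\alpha_k(x_k-x_{k-1})$ (possibly $y_d=\infty$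 for a last piece). Algorithm BPSLA: for each linear piece $k$ there are two counters $z_k^+$ and $z_k^-$, each with capacity $y_k$ and slope $\alpha_k$, initially at value $0$. An arriving positive (negative) request is associated with $z_1^+$ (with $z_1^-$). Whenever there are requests associated with both $z_k^+$ and $z_k^-$ for the same $k$, one from each is matched together and removed from the counters. Let $P_k(t)$ (resp. $N_k(t)$) be the number of positive (negative) requests associated with $z_k^+$ (with $z_k^-$) at time $t$, and $sur_k(t)=\sum_{i=1}^k (P_i(t)-N_i(t))$. At every time $t$, simultaneously for all $k$: $z_k^+$ (resp. $z_k^-$) increases at rate $\alpha_k|sur_k(t)|$ if and only if at least one request is associated with it and $sur_k(t)>0$ (resp. $sur_k(t)<0$); otherwise it stays constant. When $z_k^+$ (resp. $z_k^-$) reaches its capacity $y_k$, a single request associated with it is moved to $z_{k+1}^+$ (resp. $z_{k+1}^-$), and both $z_k^+$ and $z_k^-$ are reset to $0$. If a counter reaches capacity at the same instant at which a request arrives, the move is performed first. Other ties are broken arbitrarily. *)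

theory Defs
  imports "HOL-Analysis.Analysis" "HOL-Library.Extended_Nat"
begin

section \<open>Delay functions\<close>

text \<open>Functions on $[0,\infty)$ are total functions on the reals of which only the
  restriction to \<open>{0..}\<close> is constrained or used.\<close>

definition admissible :: "(real \<Rightarrow> real) \<Rightarrow> bool" where
  "admissible D \<longleftrightarrow>
     (\<forall>t\<ge>0. 0 \<le> D t) \<and> D 0 = 0 \<and>
     concave_on {0..} D \<and> continuous_on {0..} D \<and> mono_on {0..} D \<and>
     (\<exists>B. (\<forall>t\<ge>0. \<exists>D'. (D has_real_derivative D') (at_right t) \<and> 0 < D' \<and> D' \<le> B) \<and>
          (\<forall>t>0. \<exists>D'. (D has_real_derivative D') (at_left t) \<and> 0 < D' \<and> D' \<le> B)) \<and>
     filterlim D at_top at_top"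

text \<open>A decomposition into pieces is given by the number of pieces \<open>d\<close> (possibly infinite),
  the breakpoints \<open>x 0, x 1, \<dots>\<close> and the slopes \<open>\<alpha> 1, \<alpha> 2, \<dots>\<close>. Piece \<open>k\<close> lives on
  $[x_{k-1},x_k)$. Values of \<open>x\<close> and \<open>\<alpha>\<close> beyond index \<open>d\<close> are irrelevant.\<close>

definition pieces :: "enat \<Rightarrow> nat set" where
  "pieces d = {k. 1 \<le> k \<and> enat k \<le> d}"

definition exp_decreasing_pl ::
    "(real \<Rightarrow> real) \<Rightarrow> enat \<Rightarrow> (nat \<Rightarrow> ereal) \<Rightarrow> (nat \<Rightarrow> real) \<Rightarrow> bool" where
  "exp_decreasing_pl f d x \<alpha> \<longleftrightarrow>
     continuous_on {0..} f \<and> f 0 = 0 \<and>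
     1 \<le> d \<and> x 0 = 0 \<and>
     (\<forall>k\<in>pieces d. x (k - 1) < x k) \<and>
     (\<forall>k\<in>pieces d. 0 < \<alpha> k) \<and>
     (\<forall>k\<in>pieces d. Suc k \<in> pieces d \<longrightarrow> \<alpha> k \<ge> 2 * \<alpha> (Suc k)) \<and>
     (\<forall>k\<in>pieces d. \<exists>c. \<forall>t. x (k - 1) \<le> ereal t \<and> ereal t < x k \<longrightarrow> f t = \<alpha> k * t + c) \<and>
     (case d of enat n \<Rightarrow> x n = \<infinity> | \<infinity> \<Rightarrow> x \<longlonglongrightarrow> \<infinity>)"

text \<open>$y_k$; it is infinite exactly when piece \<open>k\<close> is unbounded.\<close>

definition capacity :: "(nat \<Rightarrow> ereal) \<Rightarrow> (nat \<Rightarrow> real) \<Rightarrow> nat \<Rightarrow> ereal" where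
  "capacity x \<alpha> k = ereal (\<alpha> k) * (x k - x (k - 1))"


section \<open>The matching problem\<close>

datatype polarity = Positive | Negative

record mbpmd =
  requests :: "nat set"
  arrival :: "nat \<Rightarrow> real"
  polarity :: "nat \<Rightarrow> polarity"

definition valid_instance :: "mbpmd \<Rightarrow> bool" where
  "valid_instance I \<longleftrightarrow>
     finite (requests I) \<and>
     (\<forall>r\<in>requests I. 0 \<le> arrival I r) \<and>
     card {r \<in> requests I. polarity I r = Positive} =
     card {r \<in> requests I. polarity I r = Negative}"

record solution =
  partner :: "nat \<Rightarrow> nat"
  match_time :: "nat \<Rightarrow> real"

definition feasible :: "mbpmd \<Rightarrow> solution \<Rightarrow> bool" where
  "feasible I S \<longleftrightarrow>
     (\<forall>r\<in>requests I.
        partner S r \<in> requests I \<and>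
        polarity I (partner S r) \<noteq> polarity I r \<and>
        partner S (partner S r) = r \<and>
        match_time S (partner S r) = match_time S r \<and>
        arrival I r \<le> match_time S r)"

definition cost :: "(real \<Rightarrow> real) \<Rightarrow> mbpmd \<Rightarrow> solution \<Rightarrow> real" where
  "cost D I S = (\<Sum>r\<in>requests I. D (match_time S r - arrival I r))"

definition optimal :: "(real \<Rightarrow> real) \<Rightarrow> mbpmd \<Rightarrow> solution \<Rightarrow> bool" where
  "optimal D I S \<longleftrightarrow> feasible I S \<and> (\<forall>S'. feasible I S' \<longrightarrow> cost D I S \<le> cost D I S')"


section \<open>The algorithm BPSLA\<close>

text \<open>BPSLA is an event-driven transition system. Between events all counters grow at constant
  rates, so a configuration records the state at one instant, and several transitions may
  happen at the same instant. A request is \<open>Waiting k\<close> while it is associated with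
  $z_k^+$ or $z_k^-$ (according to its polarity); \<open>Matched q t\<close> means matched with
  \<open>q\<close> at time \<open>t\<close>.\<close>

datatype status = Unarrived | Waiting nat | Matched nat real

record config =
  now :: real
  stat :: "nat \<Rightarrow> status"
  counter :: "polarity \<Rightarrow> nat \<Rightarrow> real"

definition initial :: config where
  "initial = \<lparr>now = 0, stat = (\<lambda>_. Unarrived), counter = (\<lambda>_ _. 0)\<rparr>"

definition waiting :: "mbpmd \<Rightarrow> config \<Rightarrow> polarity \<Rightarrow> nat \<Rightarrow> nat set" where
  "waiting I c s k = {r \<in> requests I. polarity I r = s \<and> stat c r = Waiting k}"

definition sur :: "mbpmd \<Rightarrow> config \<Rightarrow> nat \<Rightarrow> real" where
  "sur I c k =
     (\<Sum>i = 1..k. real (card (waiting I c Positive i)) - real (card (waiting I c Negative i)))"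

definition rate :: "(nat \<Rightarrow> real) \<Rightarrow> mbpmd \<Rightarrow> config \<Rightarrow> polarity \<Rightarrow> nat \<Rightarrow> real" where
  "rate \<alpha> I c s k =
     (if waiting I c s k \<noteq> {} \<and>
         (case s of Positive \<Rightarrow> sur I c k > 0 | Negative \<Rightarrow> sur I c k < 0)
      then \<alpha> k * \<bar>sur I c k\<bar> else 0)"

definition full ::
    "enat \<Rightarrow> (nat \<Rightarrow> ereal) \<Rightarrow> (nat \<Rightarrow> real) \<Rightarrow> config \<Rightarrow> polarity \<Rightarrow> nat \<Rightarrow> bool" where
  "full d x \<alpha> c s k \<longleftrightarrow> k \<in> pieces d \<and> ereal (counter c s k) = capacity x \<alpha> k"

definition match_pending :: "mbpmd \<Rightarrow> config \<Rightarrow> bool" where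
  "match_pending I c \<longleftrightarrow> (\<exists>k. waiting I c Positive k \<noteq> {} \<and> waiting I c Negative k \<noteq> {})"

definition elapse :: "(nat \<Rightarrow> real) \<Rightarrow> mbpmd \<Rightarrow> real \<Rightarrow> config \<Rightarrow> config" where
  "elapse \<alpha> I \<delta> c =
     c\<lparr>now := now c + \<delta>, counter := (\<lambda>s k. counter c s k + \<delta> * rate \<alpha> I c s k)\<rparr>"

text \<open>Matches have priority over everything else, moves have priority over arrivals, and time
  passes only if nothing is left to do at the current instant. All remaining ties (which pair
  is matched, which request is moved, which full counter or which simultaneous arrival is
  handled first) are resolved nondeterministically. Rule \<open>wait\<close> lets time pass exactly until
  the next instant at which a counter fills up or a request arrives; hence a run cannot
  subdivide a time interval indefinitely.\<close>

inductive bpsla_step ::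
    "enat \<Rightarrow> (nat \<Rightarrow> ereal) \<Rightarrow> (nat \<Rightarrow> real) \<Rightarrow> mbpmd \<Rightarrow> config \<Rightarrow> config \<Rightarrow> bool"
  for d x \<alpha> I where
  match:
    "\<lbrakk>p \<in> waiting I c Positive k; q \<in> waiting I c Negative k\<rbrakk> \<Longrightarrow>
     bpsla_step d x \<alpha> I c (c\<lparr>stat := (stat c)(p := Matched q (now c), q := Matched p (now c))\<rparr>)"
| move:
    "\<lbrakk>\<not> match_pending I c; full d x \<alpha> c s k; r \<in> waiting I c s k\<rbrakk> \<Longrightarrow>
     bpsla_step d x \<alpha> I c
       (c\<lparr>stat := (stat c)(r := Waiting (Suc k)),
          counter := (\<lambda>s' j. if j = k then 0 else counter c s' j)\<rparr>)"
| arrive: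
    "\<lbrakk>\<not> match_pending I c; \<nexists>s k. full d x \<alpha> c s k;
      r \<in> requests I; stat c r = Unarrived; arrival I r = now c\<rbrakk> \<Longrightarrow>
     bpsla_step d x \<alpha> I c (c\<lparr>stat := (stat c)(r := Waiting 1)\<rparr>)"
| wait:
    "\<lbrakk>\<not> match_pending I c; \<nexists>s k. full d x \<alpha> c s k; 0 < \<delta>;
      \<forall>r\<in>requests I. stat c r = Unarrived \<longrightarrow> now c + \<delta> \<le> arrival I r;
      \<forall>s. \<forall>k\<in>pieces d. ereal (counter (elapse \<alpha> I \<delta> c) s k) \<le> capacity x \<alpha> k;
      (\<exists>s k. full d x \<alpha> (elapse \<alpha> I \<delta> c) s k) \<or>
      (\<exists>r\<in>requests I. stat c r = Unarrived \<and> arrival I r = now c + \<delta>)\<rbrakk> \<Longrightarrow>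
     bpsla_step d x \<alpha> I c (elapse \<alpha> I \<delta> c)"

text \<open>A run is a maximal sequence of transitions; it stutters once no transition is possible.\<close>

definition bpsla_run ::
    "enat \<Rightarrow> (nat \<Rightarrow> ereal) \<Rightarrow> (nat \<Rightarrow> real) \<Rightarrow> mbpmd \<Rightarrow> (nat \<Rightarrow> config) \<Rightarrow> bool" where
  "bpsla_run d x \<alpha> I run \<longleftrightarrow>
     run 0 = initial \<and>
     (\<forall>n. bpsla_step d x \<alpha> I (run n) (run (Suc n)) \<or>
          (\<nexists>c. bpsla_step d x \<alpha> I (run n) c) \<and> run (Suc n) = run n)"

text \<open>Status \<open>Matched\<close> is never revoked, so \<open>S\<close> is determined on the requests of \<open>I\<close>.\<close>

definition produces :: "mbpmd \<Rightarrow> (nat \<Rightarrow> config) \<Rightarrow> solution \<Rightarrow> bool" where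
  "produces I run S \<longleftrightarrow>
     (\<forall>r\<in>requests I. \<exists>n. stat (run n) r = Matched (partner S r) (match_time S r))"


section \<open>Runs and optimal solutions exist\<close>

lemma bpsla_run_exists: "\<exists>run. bpsla_run d x \<alpha> I run"
proof -
  define nxt where "nxt c = (if \<exists>c'. bpsla_step d x \<alpha> I c c' then SOME c'. bpsla_step d x \<alpha> I c c' else c)" for c
  have "bpsla_step d x \<alpha> I c (nxt c) \<or> (\<nexists>c'. bpsla_step d x \<alpha> I c c') \<and> nxt c = c" for c
    by (auto simp: nxt_def intro: someI_ex)
  then have "bpsla_run d x \<alpha> I (\<lambda>n. (nxt ^^ n) initial)"
    by (simp add: bpsla_run_def)
  then show ?thesis by blast
qed

lemma feasible_exists:
  assumes "valid_instance I"
  shows "\<exists>S. feasible I S"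
proof -
  let ?P = "{r \<in> requests I. polarity I r = Positive}"
  let ?N = "{r \<in> requests I. polarity I r = Negative}"
  have fin: "finite (requests I)" and "card ?P = card ?N"
    using assms by (auto simp: valid_instance_def)
  then obtain g where g: "bij_betw g ?P ?N"
    by (metis (no_types, lifting) finite_same_card_bij finite_subset mem_Collect_eq subsetI)
  define h where "h = inv_into ?P g"
  have gh: "g r \<in> ?N \<and> h (g r) = r" if "r \<in> ?P" for r
    unfolding h_def using bij_betw_inv_into_left[OF g that] bij_betwE[OF g] that by blast
  have hg: "h r \<in> ?P \<and> g (h r) = r" if "r \<in> ?N" for r
    unfolding h_def using bij_betw_inv_into_right[OF g that] bij_betwE[OF bij_betw_inv_into[OF g]] that
    by blast
  define S where "S = \<lparr>partner = (\<lambda>r. if polarity I r = Positive then g r else h r),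
     match_time = (\<lambda>_. Max (arrival I ` requests I))\<rparr>"
  have "polarity I r = Positive \<or> polarity I r = Negative" for r by (cases "polarity I r") auto
  then have "feasible I S"
    unfolding feasible_def S_def using gh hg fin by force
  then show ?thesis by blast
qed

text \<open>Matching every pair as soon as both requests have arrived is best for a fixed set of pairs,
  and there are finitely many sets of pairs.\<close>

lemma optimal_exists:
  assumes D: "admissible D" and I: "valid_instance I"
  shows "\<exists>S. optimal D I S"
proof -
  let ?R = "requests I"
  have fin: "finite ?R" using I by (simp add: valid_instance_def)
  define asap where "asap S = \<lparr>partner = restrict (partner S) ?R,
    match_time = (\<lambda>r. max (arrival I r) (arrival I (restrict (partner S) ?R r)))\<rparr>" for S :: solution
  define X where "X = asap ` Collect (feasible I)"
  have feas: "feasible I (asap S)" if "feasible I S" for S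
    using that by (auto simp: feasible_def asap_def max.commute)
  have better: "cost D I (asap S) \<le> cost D I S" if S: "feasible I S" for S
    unfolding cost_def
  proof (rule sum_mono)
    fix r assume r: "r \<in> ?R"
    have "match_time (asap S) r \<le> match_time S r" "arrival I r \<le> match_time (asap S) r"
      using S r by (auto simp: feasible_def asap_def) (metis order_refl)
    then show "D (match_time (asap S) r - arrival I r) \<le> D (match_time S r - arrival I r)"
      using D by (auto simp: admissible_def intro!: mono_onD[of "{0..}" D])
  qed
  have "X \<subseteq> (\<lambda>g. \<lparr>partner = g, match_time = (\<lambda>r. max (arrival I r) (arrival I (g r)))\<rparr>) ` (?R \<rightarrow>\<^sub>E ?R)"
    by (auto simp: X_def asap_def feasible_def intro!: image_eqI)
  then have "finite X" by (rule finite_subset) (simp add: fin finite_PiE)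
  moreover have "X \<noteq> {}" using feasible_exists[OF I] by (auto simp: X_def)
  ultimately obtain S where S: "S \<in> X" "\<And>S'. S' \<in> X \<Longrightarrow> cost D I S \<le> cost D I S'"
    using arg_min_if_finite[of X "cost D I"] by (metis not_less)
  then have "optimal D I S"
    using feas better unfolding optimal_def X_def
    by (smt (verit) image_iff mem_Collect_eq)
  then show ?thesis by blast
qed

end

theory Submission
  imports Defs
begin

text \<open>Fix an offline solution and call the distance of the arrival times of two partners their
  gap. At level \<open>k\<close> compare the surplus of the algorithm with the surplus \<open>target\<close> of the arrived
  requests whose gap is below $x_k$. The integral of $\alpha_k$ times the absolute target, summed
  over \<open>k\<close>, is at most twice the \<open>f\<close>-cost of all gaps, because the slopes halve. The difference
  \<open>offset\<close> changes only if the algorithm moves a request at level \<open>k\<close>, or if a request with gap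
  at least $x_k$ arrives; the latter is worth $y_k$ to the offline solution.

  The potential of a level charges $4 y_k$ per unit of offset, minus three times the counter whose
  overflow will bring the offset closer to zero, plus eight times the other counter. While a helpful
  counter rises, the potential pays for three times its rate. While any other counter rises, the
  target is at least as large in absolute value as the surplus, so the offline solution pays. Each
  move out of level \<open>k\<close> releases at least $y_k$, which covers the delay between the two levels.
  Finally, the delay cost of the algorithm grows at most at three times the total rate of all counters.

  The resulting bound on the cost also bounds the levels that are ever used, whence termination.\<close>

section \<open>Piecewise linear functions\<close>

locale pl_fun =
  fixes f :: "real \<Rightarrow> real" and d :: enat and x :: "nat \<Rightarrow> ereal" and \<alpha> :: "nat \<Rightarrow> real"
  assumes pl: "exp_decreasing_pl f d x \<alpha>"
begin

text \<open>\<open>X k\<close> and \<open>Y k\<close> are 0 when piece \<open>k\<close> is unbounded; the potential of such a level is harmless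
  because its offset vanishes.\<close>

definition X :: "nat \<Rightarrow> real" where "X k = real_of_ereal (x k)"
definition Y :: "nat \<Rightarrow> real" where "Y k = real_of_ereal (capacity x \<alpha> k)"

lemma f_0 [simp]: "f 0 = 0" and x_0: "x 0 = 0" and X_0 [simp]: "X 0 = 0"
  and one_in_pieces: "Suc 0 \<in> pieces d"
  using pl by (auto simp: exp_decreasing_pl_def X_def pieces_def one_enat_def)

section \<open>Breakpoints, slopes and capacities\<close>

lemma pieces_le: "k \<in> pieces d \<Longrightarrow> 1 \<le> j \<Longrightarrow> j \<le> k \<Longrightarrow> j \<in> pieces d"
  unfolding pieces_def using order_trans[of "enat j" "enat k" d] by auto

lemma piecesD: "k \<in> pieces d \<Longrightarrow> 1 \<le> k"
  by (simp add: pieces_def)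

lemma slope_pos: "k \<in> pieces d \<Longrightarrow> 0 < \<alpha> k"
  using pl by (simp add: exp_decreasing_pl_def)

lemma slope_halves: "1 \<le> k \<Longrightarrow> Suc k \<in> pieces d \<Longrightarrow> 2 * \<alpha> (Suc k) \<le> \<alpha> k"
  using pl pieces_le[of "Suc k" k] by (auto simp: exp_decreasing_pl_def)

lemma x_less: "k \<in> pieces d \<Longrightarrow> x (k - 1) < x k"
  using pl by (simp add: exp_decreasing_pl_def)

lemma x_mono: "k \<in> pieces d \<Longrightarrow> j \<le> k \<Longrightarrow> x j \<le> x k"
proof (induction k arbitrary: j)
  case (Suc k)
  show ?case
  proof (cases "j = Suc k")
    case False
    then have j: "j \<le> k" using Suc.prems by simp
    have "x j \<le> x k"
    proof (cases "k = 0")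
      case False
      then show ?thesis using Suc.IH[of j] j pieces_le[OF Suc.prems(1), of k] by simp
    qed (use j in simp)
    then show ?thesis using x_less[OF Suc.prems(1)] by simp
  qed simp
qed (simp add: pieces_def)

lemma x_nonneg: "k \<in> pieces d \<Longrightarrow> 0 \<le> x k"
  using x_mono[of k 0] x_0 by simp

lemma x_prev: "k \<in> pieces d \<Longrightarrow> x (k - 1) = ereal (X (k - 1)) \<and> 0 \<le> X (k - 1)"
  using x_less[of k] x_mono[of k "k - 1"] x_nonneg[of "k - 1"] x_0 pieces_le[of k "k - 1"]
  unfolding X_def by (cases "x (k - 1)"; cases "k - 1 = 0") auto

lemma x_pos: "k \<in> pieces d \<Longrightarrow> 0 < x k"
  using x_less[of k] x_prev[of k] by (cases "x k") auto

lemma x_infinite_iff: "k \<in> pieces d \<Longrightarrow> x k = \<infinity> \<longleftrightarrow> d = enat k"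
proof
  assume k: "k \<in> pieces d" and inf: "x k = \<infinity>"
  show "d = enat k"
  proof (rule ccontr)
    assume "d \<noteq> enat k"
    then have "Suc k \<in> pieces d"
      using k by (cases d) (auto simp: pieces_def)
    from x_less[OF this] inf show False by simp
  qed
next
  assume "d = enat k"
  then show "x k = \<infinity>" using pl by (simp add: exp_decreasing_pl_def)
qed

lemma x_finite: "k \<in> pieces d \<Longrightarrow> d \<noteq> enat k \<Longrightarrow> x k = ereal (X k) \<and> X (k - 1) < X k"
  using x_infinite_iff[of k] x_pos[of k] x_less[of k] x_prev[of k]
  by (cases "x k") (auto simp: X_def[of k])

lemma capacity_finite: "k \<in> pieces d \<Longrightarrow> d \<noteq> enat k \<Longrightarrow>
    capacity x \<alpha> k = ereal (Y k) \<and> 0 < Y k \<and> Y k = \<alpha> k * (X k - X (k - 1))"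
  using x_finite[of k] x_prev[of k] slope_pos[of k] unfolding Y_def capacity_def by simp

lemma capacity_last: "k \<in> pieces d \<Longrightarrow> d = enat k \<Longrightarrow> capacity x \<alpha> k = \<infinity> \<and> Y k = 0"
  using x_infinite_iff[of k] x_prev[of k] slope_pos[of k] unfolding Y_def capacity_def by simp

lemma Y_nonneg: "k \<in> pieces d \<Longrightarrow> 0 \<le> Y k"
  using capacity_finite[of k] capacity_last[of k] by (cases "d = enat k") auto

lemma capacity_pos: "k \<in> pieces d \<Longrightarrow> 0 < capacity x \<alpha> k"
  using capacity_finite[of k] capacity_last[of k] by (cases "d = enat k") auto

section \<open>Increments of \<open>f\<close>\<close>

lemma f_affine:
  assumes k: "k \<in> pieces d" and t: "x (k - 1) \<le> ereal t" "t \<le> t'" "ereal t' \<le> x k"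
  shows "f t' - f t = \<alpha> k * (t' - t)"
proof -
  obtain c where c: "\<And>t. x (k - 1) \<le> ereal t \<Longrightarrow> ereal t < x k \<Longrightarrow> f t = \<alpha> k * t + c"
    using pl k unfolding exp_decreasing_pl_def by blast
  have *: "f s = \<alpha> k * s + c" if s: "x (k - 1) \<le> ereal s" "ereal s \<le> x k" for s
  proof (cases "ereal s < x k")
    case False
    with s have xk: "x k = ereal s" by simp
    have fin: "x (k - 1) = ereal (X (k - 1))" "0 \<le> X (k - 1)" using x_prev[OF k] by auto
    have lt: "X (k - 1) < s" using x_less[OF k] xk fin by simp
    \<comment> \<open>The definition fixes \<open>f\<close> only on the half-open piece. Left
      continuity carries the formula to the right breakpoint, so that neighbouring pieces can be
      glued.\<close>
    have "continuous_on {X (k - 1)..s} f"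
      using pl fin unfolding exp_decreasing_pl_def by (auto elim: continuous_on_subset)
    then have "(f \<longlongrightarrow> f s) (at s within {X (k - 1)..s})"
      using lt by (simp add: continuous_on)
    then have "(f \<longlongrightarrow> f s) (at_left s)"
      using lt at_within_Icc_at_left by metis
    moreover have "((\<lambda>t. \<alpha> k * t + c) \<longlongrightarrow> \<alpha> k * s + c) (at_left s)"
      by (intro tendsto_intros)
    moreover have "f t = \<alpha> k * t + c" if "X (k - 1) < t" "t < s" for t
      using c[of t] that fin xk by simp
    then have "eventually (\<lambda>t. \<alpha> k * t + c = f t) (at_left s)"
      unfolding eventually_at_left_field using lt by metis
    ultimately have lim: "(f \<longlongrightarrow> f s) (at_left s)" "(f \<longlongrightarrow> \<alpha> k * s + c) (at_left s)"
      using Lim_transform_eventually by blast+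
    show ?thesis by (rule tendsto_unique[OF trivial_limit_at_left_real lim])
  qed (use c s in auto)
  have "ereal t \<le> x k" "x (k - 1) \<le> ereal t'"
    using t by (auto intro: order_trans[of _ "ereal t'"] order_trans[of _ "ereal t"])
  with * t show ?thesis by (auto simp: algebra_simps)
qed

text \<open>Slopes decrease, so an increment spread over pieces \<open>i\<close> to \<open>j\<close>
  lies between the two extreme slopes. Induction on \<open>j\<close> cuts the interval at
  \<open>X j\<close>; the comparison of slopes is carried along because the induction step needs
  it.\<close>

lemma f_slope_bounds:
  assumes "j \<in> pieces d" "1 \<le> i" "i \<le> j" "x (i - 1) \<le> ereal t" "t \<le> t'" "ereal t' \<le> x j"
  shows "\<alpha> j * (t' - t) \<le> f t' - f t \<and> f t' - f t \<le> \<alpha> i * (t' - t) \<and> \<alpha> j \<le> \<alpha> i"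
  using assms(3,1,2,4-)
proof (induction j arbitrary: t t' rule: dec_induct)
  case base
  then show ?case using f_affine[of i t t'] by simp
next
  case (step j)
  let ?k = "Suc j"
  have j: "j \<in> pieces d" and jk: "j \<le> ?k" using step.hyps step.prems pieces_le by auto
  have jd: "d \<noteq> enat j" using step.prems by (auto simp: pieces_def)
  have xj: "x j = ereal (X j)" using x_finite[OF j jd] by simp
  have a: "\<alpha> ?k \<le> \<alpha> j" using slope_halves[of j] slope_pos[of ?k] step by simp
  have i0: "x (i - 1) \<le> ereal (X j)" using x_mono[OF j, of "i - 1"] step xj by simp
  have aji: "\<alpha> j \<le> \<alpha> i" using step.IH[of "X j" "X j"] j step.prems xj i0 by simp
  have low: "\<alpha> j * (s' - s) \<le> f s' - f s \<and> f s' - f s \<le> \<alpha> i * (s' - s)"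
    if "x (i - 1) \<le> ereal s" "s \<le> s'" "s' \<le> X j" for s s'
    using step.IH[of s s'] that j step.prems xj by simp
  have high: "f s' - f s = \<alpha> ?k * (s' - s)" if "X j \<le> s" "s \<le> s'" "ereal s' \<le> x ?k" for s s'
    using f_affine[of ?k s s'] that step.prems xj by simp
  have cmp: "\<alpha> ?k * u \<le> \<alpha> j * u" "\<alpha> j * u \<le> \<alpha> i * u" if "0 \<le> u" for u
    using that a aji by (auto intro: mult_right_mono)
  consider "t' \<le> X j" | "X j \<le> t" | "t \<le> X j" "X j \<le> t'" by linarith
  then have "\<alpha> ?k * (t' - t) \<le> f t' - f t \<and> f t' - f t \<le> \<alpha> i * (t' - t)"
  proof cases
    case 1
    then show ?thesis using low[of t t'] cmp[of "t' - t"] step.prems by force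
  next
    case 2
    then show ?thesis using high[of t t'] cmp[of "t' - t"] step.prems by force
  next
    case 3
    have "\<alpha> ?k * (t' - t) = \<alpha> ?k * (t' - X j) + \<alpha> ?k * (X j - t)"
      "\<alpha> i * (t' - t) = \<alpha> i * (t' - X j) + \<alpha> i * (X j - t)" by (simp_all add: algebra_simps)
    then show ?thesis
      using low[of t "X j"] high[of "X j" t'] cmp[of "t' - X j"] cmp[of "X j - t"] 3 step.prems by force
  qed
  then show ?case using a aji by simp
qed

text \<open>Finitely many pieces end in an unbounded one. Infinitely many have breakpoints tending
  to infinity, and then the index can also be pushed beyond \<open>m\<close>.\<close>

lemma piece_above: obtains k where "k \<in> pieces d" "m \<le> k \<or> d = enat k" "ereal t \<le> x k"
proof (cases d)
  case (enat n)
  then have "n \<in> pieces d" using one_in_pieces by (auto simp: pieces_def)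
  then show ?thesis using that[of n] x_infinite_iff[of n] enat by simp
next
  case infinity
  then have "x \<longlonglongrightarrow> \<infinity>" using pl by (simp add: exp_decreasing_pl_def)
  then have "eventually (\<lambda>n. ereal t < x n) sequentially"
    by (simp add: tendsto_PInfty)
  moreover have "eventually (\<lambda>n. max 1 m \<le> n) sequentially" by (rule eventually_ge_at_top)
  ultimately have "eventually (\<lambda>n. ereal t < x n \<and> max 1 m \<le> n) sequentially"
    by (rule eventually_conj)
  then obtain n where "ereal t < x n" "max 1 m \<le> n"
    by (auto simp: eventually_sequentially)
  then show ?thesis using that[of n] infinity by (auto simp: pieces_def)
qed

lemma f_Lipschitz:
  assumes "i \<in> pieces d" "X (i - 1) \<le> t" "t \<le> t'"
  shows "f t \<le> f t'" "f t' - f t \<le> \<alpha> i * (t' - t)"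
proof -
  obtain k where k: "k \<in> pieces d" "i \<le> k \<or> d = enat k" "ereal t' \<le> x k" by (rule piece_above)
  have ik: "i \<le> k" using k assms(1) by (auto simp: pieces_def)
  have "\<alpha> k * (t' - t) \<le> f t' - f t \<and> f t' - f t \<le> \<alpha> i * (t' - t)"
    using f_slope_bounds[OF k(1) piecesD[OF assms(1)] ik, of t t'] x_prev[OF assms(1)] assms k by simp
  moreover have "0 \<le> \<alpha> k * (t' - t)" using slope_pos[OF k(1)] assms by simp
  ultimately show "f t \<le> f t'" "f t' - f t \<le> \<alpha> i * (t' - t)" by auto
qed

lemma f_mono: "0 \<le> t \<Longrightarrow> t \<le> t' \<Longrightarrow> f t \<le> f t'"
  using f_Lipschitz(1)[OF one_in_pieces] by simp

lemma f_nonneg: "0 \<le> t \<Longrightarrow> 0 \<le> f t"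
  using f_mono[of 0 t] by simp

text \<open>This bounds the growth of the charge of a request waiting at level \<open>i\<close>.
  Before the age reaches \<open>X (i - 1)\<close> the slope of \<open>f\<close> may be steeper, but
  there the maximum is constant; afterwards the slope is at most that of piece
  \<open>i\<close>.\<close>

lemma f_growth:
  assumes "i \<in> pieces d" "0 \<le> t" "0 \<le> \<delta>"
  shows "max (f (t + \<delta>)) (f (X (i - 1))) \<le> max (f t) (f (X (i - 1))) + \<alpha> i * \<delta>"
proof -
  let ?b = "X (i - 1)"
  have b: "0 \<le> ?b" using x_prev[OF assms(1)] by simp
  have ad: "0 \<le> \<alpha> i * \<delta>" using slope_pos[OF assms(1)] assms by simp
  have "f (t + \<delta>) \<le> max (f t) (f ?b) + \<alpha> i * \<delta>"
  proof (cases "?b \<le> t")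
    case True
    then show ?thesis using f_Lipschitz(2)[OF assms(1), of t "t + \<delta>"] assms by simp
  next
    case False
    then have "f (t + \<delta>) \<le> f (?b + \<delta>)" using f_mono[of "t + \<delta>" "?b + \<delta>"] assms by simp
    also have "\<dots> \<le> f ?b + \<alpha> i * \<delta>" using f_Lipschitz(2)[OF assms(1), of ?b "?b + \<delta>"] assms by simp
    finally show ?thesis by simp
  qed
  then show ?thesis using ad by simp
qed

section \<open>Summing over the levels for a single gap\<close>

lemma f_breakpoint: "k \<in> pieces d \<Longrightarrow> d \<noteq> enat k \<Longrightarrow> f (X k) = f (X (k - 1)) + Y k"
  using f_affine[of k "X (k - 1)" "X k"] x_finite[of k] x_prev[of k] capacity_finite[of k] by simp

text \<open>The capacities are the increments of \<open>f\<close> between breakpoints, so the sum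
  telescopes. The induction is strengthened by the exact value \<open>f (X K)\<close>, valid as long
  as all breakpoints so far are at most \<open>g\<close>.\<close>

lemma sum_capacities_le:
  assumes "K \<in> pieces d" "0 \<le> g"
  shows "(\<Sum>k=1..K. if x k \<le> ereal g then Y k else 0) \<le> f g"
proof -
  have "(\<Sum>k=1..K. if x k \<le> ereal g then Y k else 0) \<le> f g \<and>
     (x K \<le> ereal g \<longrightarrow> (\<Sum>k=1..K. if x k \<le> ereal g then Y k else 0) = f (X K))"
    using piecesD[OF assms(1)] assms(1)
  proof (induction K rule: dec_induct)
    case base
    show ?case
    proof (cases "x 1 \<le> ereal g")
      case True
      then have d1: "d \<noteq> enat 1" using x_infinite_iff[OF base] by auto
      have "0 < X 1" "X 1 \<le> g" using True x_finite[OF base d1] by auto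
      moreover have "f (X 1) = Y 1" using f_breakpoint[OF base d1] by simp
      ultimately show ?thesis using True f_mono[of "X 1" g] by simp
    next
      case False
      then show ?thesis using f_nonneg[OF assms(2)] by simp
    qed
  next
    case (step k)
    have k: "k \<in> pieces d" using pieces_le[OF step.prems, of k] step.hyps by simp
    show ?case
    proof (cases "x (Suc k) \<le> ereal g")
      case True
      then have dk: "d \<noteq> enat (Suc k)" using x_infinite_iff[OF step.prems] by auto
      have "X k < X (Suc k)" "X (Suc k) \<le> g" "x k \<le> ereal g" "0 \<le> X k"
        using True x_finite[OF step.prems dk] x_prev[OF step.prems] by auto
      moreover from this have "(\<Sum>k=1..Suc k. if x k \<le> ereal g then Y k else 0) = f (X (Suc k))"
        using step.IH[OF k] f_breakpoint[OF step.prems dk] True by simp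
      ultimately show ?thesis using f_mono[of "X (Suc k)" g] True by simp
    next
      case False
      then show ?thesis using step.IH[OF k] by simp
    qed
  qed
  then show ?thesis by blast
qed

text \<open>The nonzero terms start at the piece containing \<open>g\<close>, where the term is at
  most \<open>f g\<close>, and then halve. In the induction the last term is counted twice: its
  second copy pays for the geometric tail.\<close>

lemma sum_slopes_le:
  assumes "K \<in> pieces d" "0 \<le> g"
  shows "(\<Sum>k=1..K. if ereal g < x k then \<alpha> k * g else 0) \<le> 2 * f g"
proof -
  have "(\<Sum>k=1..K. if ereal g < x k then \<alpha> k * g else 0) + (if ereal g < x K then \<alpha> K * g else 0) \<le> 2 * f g"
    using piecesD[OF assms(1)] assms(1)
  proof (induction K rule: dec_induct)
    case base
    show ?case
      using f_nonneg[OF assms(2)] f_slope_bounds[OF base, of 1 0 g] assms x_0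
      by (cases "ereal g < x 1") (auto simp: algebra_simps)
  next
    case (step k)
    have k: "k \<in> pieces d" using pieces_le[OF step.prems, of k] step.hyps by simp
    have *: "\<alpha> (Suc k) * g \<le> f g" if "ereal g < x (Suc k)"
      using f_slope_bounds[OF step.prems, of 1 0 g] assms x_0 that by simp
    have **: "2 * \<alpha> (Suc k) * g \<le> \<alpha> k * g"
      using slope_halves[of k] step assms by (auto intro: mult_right_mono)
    show ?case
    proof (cases "ereal g < x k")
      case True
      then show ?thesis using step.IH[OF k] ** step.hyps x_mono[OF step.prems, of k] by auto
    next
      case False
      then have "\<not> ereal g < x j" if "j \<le> k" for j
        using x_mono[OF k that] by auto
      then have "(\<Sum>k=1..k. if ereal g < x k then \<alpha> k * g else 0) = 0" by (intro sum.neutral) auto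
      then show ?thesis using * f_nonneg[OF assms(2)] step.hyps by auto
    qed
  qed
  moreover have "0 \<le> (if ereal g < x K then \<alpha> K * g else 0)"
    using slope_pos[OF assms(1)] assms by auto
  ultimately show ?thesis by linarith
qed

end


section \<open>The potential of one level\<close>

text \<open>An overflow of \<open>u\<close> lowers \<open>n\<close> by one, an overflow of
  \<open>v\<close> raises it. If the harmful counter overflows, \<open>n\<close> moves away from 0
  at a price of \<open>4 * y\<close>, resetting the other counter costs up to \<open>3 * y\<close>,
  and \<open>y\<close> has to be left over: hence the weight 8. At \<open>n = 0\<close> both
  counters count as harmful.\<close>

definition phi :: "real \<Rightarrow> int \<Rightarrow> real \<Rightarrow> real \<Rightarrow> real" where
  "phi y n u v = 4 * y * \<bar>real_of_int n\<bar> +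
     (if n > 0 then 8 * v - 3 * u else if n < 0 then 8 * u - 3 * v else 8 * (u + v))"

lemma phi_uminus: "phi y (- n) v u = phi y n u v"
  by (simp add: phi_def)

text \<open>One unit of offset is worth \<open>4 * y\<close>, more than the \<open>3 * y\<close>
  that the helpful counter can take away. The bounds by \<open>y\<close> are asked only for nonzero
  \<open>n\<close> because an unbounded last level has \<open>Y\<close> equal to 0 but offset
  0.\<close>

lemma phi_nonneg:
  assumes "0 \<le> u" "0 \<le> v" "n \<noteq> 0 \<Longrightarrow> u \<le> y \<and> v \<le> y"
  shows "0 \<le> phi y n u v"
proof (cases "n = 0")
  case False
  then have "1 \<le> \<bar>real_of_int n\<bar>" by linarith
  then have "y * 1 \<le> y * \<bar>real_of_int n\<bar>" using assms False by (intro mult_left_mono) auto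
  then show ?thesis using assms False by (auto simp: phi_def)
qed (use assms in \<open>simp add: phi_def\<close>)

lemma phi_move:
  assumes "0 \<le> v" "v \<le> y"
  shows "phi y (n - 1) 0 0 + y \<le> phi y n y v"
proof -
  consider "n \<ge> 2" | "n = 1" | "n = 0" | "n < 0" by linarith
  then show ?thesis using assms by cases (auto simp: phi_def algebra_simps)
qed

lemma phi_move_neg:
  assumes "0 \<le> u" "u \<le> y"
  shows "phi y (n + 1) 0 0 + y \<le> phi y n u y"
  using phi_move[OF assms, of "- n"] phi_uminus[of y "n + 1" 0 0] phi_uminus[of y n y u] by simp

text \<open>The offset term changes by at most \<open>4 * y\<close>; the counter terms always lie
  between \<open>- 3 * y\<close> and \<open>16 * y\<close>. This gives 23, rounded up to 24.\<close>

lemma phi_jump: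
  assumes "0 \<le> u" "0 \<le> v" "u \<le> y" "v \<le> y" "\<bar>n' - n\<bar> \<le> 1"
  shows "phi y n' u v \<le> phi y n u v + 24 * y"
proof -
  have "\<bar>real_of_int n'\<bar> \<le> \<bar>real_of_int n\<bar> + 1" using assms(5) by linarith
  then have "y * \<bar>real_of_int n'\<bar> \<le> y * (\<bar>real_of_int n\<bar> + 1)" using assms by (intro mult_left_mono) auto
  then have "4 * y * \<bar>real_of_int n'\<bar> \<le> 4 * y * \<bar>real_of_int n\<bar> + 4 * y" by (simp add: algebra_simps)
  moreover have "4 * y * \<bar>real_of_int n\<bar> - 3 * y \<le> phi y n u v"
    "phi y n' u v \<le> 4 * y * \<bar>real_of_int n'\<bar> + 16 * y"
    using assms by (auto simp: phi_def)
  ultimately show ?thesis using assms by linarith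
qed

text \<open>The constant 11 is the weight 8 of a harmful counter plus the 3 demanded on the
  left.\<close>

lemma phi_rise:
  "0 \<le> h \<Longrightarrow> phi y n (u + h) v + 3 * h \<le> phi y n u v + (if n > 0 then 0 else 11 * h)"
  by (auto simp: phi_def algebra_simps)

lemma phi_rise_neg:
  "0 \<le> h \<Longrightarrow> phi y n u (v + h) + 3 * h \<le> phi y n u v + (if n < 0 then 0 else 11 * h)"
  by (auto simp: phi_def algebra_simps)


section \<open>Surpluses\<close>

definition psign :: "polarity \<Rightarrow> int" where
  "psign s = (case s of Positive \<Rightarrow> 1 | Negative \<Rightarrow> - 1)"

lemma psign_simps [simp]: "psign Positive = 1" "psign Negative = - 1"
  by (simp_all add: psign_def)

lemma polarity_neq: "s \<noteq> s' \<longleftrightarrow> psign s' = - psign s"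
  by (cases s; cases s') auto

text \<open>All quantities below are sums over requests of a function of the status, so a transition
  that updates one status changes one summand.\<close>

lemma sum_fun_upd:
  fixes h :: "'a \<Rightarrow> 'b \<Rightarrow> 'c::ab_group_add"
  assumes "finite A" "p \<in> A"
  shows "(\<Sum>r\<in>A. h r ((g(p := v)) r)) = (\<Sum>r\<in>A. h r (g r)) - h p (g p) + h p v"
proof -
  have "(\<Sum>r\<in>A - {p}. h r ((g(p := v)) r)) = (\<Sum>r\<in>A - {p}. h r (g r))"
    by (intro sum.cong) auto
  then show ?thesis using assms by (simp add: sum.remove[of A p])
qed

text \<open>The map \<open>\<pi>\<close> stands for the pairing of an offline solution. Its match
  times are left out: the gaps of the pairs already bound its cost from below.\<close>

locale bpsla = pl_fun f d x \<alpha>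
  for f :: "real \<Rightarrow> real" and d :: enat and x :: "nat \<Rightarrow> ereal" and \<alpha> :: "nat \<Rightarrow> real" +
  fixes I :: mbpmd and \<pi> :: "nat \<Rightarrow> nat"
  assumes valid: "valid_instance I"
    and \<pi>_in: "r \<in> requests I \<Longrightarrow> \<pi> r \<in> requests I"
    and \<pi>_polarity: "r \<in> requests I \<Longrightarrow> polarity I (\<pi> r) \<noteq> polarity I r"
    and \<pi>_\<pi>: "r \<in> requests I \<Longrightarrow> \<pi> (\<pi> r) = r"
begin

abbreviation "R \<equiv> requests I"
abbreviation "sg r \<equiv> psign (polarity I r)"

lemma finite_R [simp]: "finite R"
  using valid by (simp add: valid_instance_def)

lemma sum_\<pi>: "(\<Sum>r\<in>R. h (\<pi> r)) = (\<Sum>r\<in>R. h r)"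
  by (rule sum.reindex_bij_witness[of _ \<pi> \<pi>]) (auto simp: \<pi>_in \<pi>_\<pi>)

text \<open>Reindexing by the involution \<open>\<pi>\<close> turns the sum into its own
  negative.\<close>

lemma sum_closed_eq_0:
  fixes h :: "nat \<Rightarrow> int"
  assumes "\<And>r. r \<in> R \<Longrightarrow> h (\<pi> r) = - h r"
  shows "(\<Sum>r\<in>R. h r) = 0"
  using sum_\<pi>[of h] assms by (simp add: sum_negf)

definition net :: "config \<Rightarrow> nat \<Rightarrow> int" where
  "net c k = (\<Sum>r\<in>R. if stat c r = Waiting k then sg r else 0)"

text \<open>This is \<open>sur\<close> over the integers, where a nonzero surplus is at least 1 in
  absolute value.\<close>

definition surplus :: "config \<Rightarrow> nat \<Rightarrow> int" where
  "surplus c k = (\<Sum>i=1..k. net c i)"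

definition gap :: "nat \<Rightarrow> real" where
  "gap r = \<bar>arrival I r - arrival I (\<pi> r)\<bar>"

definition target :: "config \<Rightarrow> nat \<Rightarrow> int" where
  "target c k = (\<Sum>r\<in>R. if stat c r \<noteq> Unarrived \<and> ereal (gap r) < x k then sg r else 0)"

definition offset :: "config \<Rightarrow> nat \<Rightarrow> int" where
  "offset c k = surplus c k - target c k"

lemma gap_nonneg [simp]: "0 \<le> gap r"
  by (simp add: gap_def)

lemma gap_\<pi>: "r \<in> R \<Longrightarrow> gap (\<pi> r) = gap r"
  by (simp add: gap_def \<pi>_\<pi> abs_minus_commute)

lemma finite_waiting [simp]: "finite (waiting I c s k)"
  by (simp add: waiting_def)

lemma net_eq: "net c k = int (card (waiting I c Positive k)) - int (card (waiting I c Negative k))"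
proof -
  have card: "int (card (waiting I c s k)) = (\<Sum>r\<in>R. if polarity I r = s \<and> stat c r = Waiting k then 1 else 0)" for s
    unfolding waiting_def by (simp add: sum.If_cases Int_def)
  have "(if stat c r = Waiting k then sg r else 0) =
      (if polarity I r = Positive \<and> stat c r = Waiting k then 1 else 0) -
      (if polarity I r = Negative \<and> stat c r = Waiting k then 1 else 0)" for r
    by (cases "polarity I r") auto
  then show ?thesis unfolding card net_def sum_subtractf[symmetric] by simp
qed

lemma sur_eq: "sur I c k = real_of_int (surplus c k)"
  unfolding sur_def surplus_def by (simp add: net_eq)

lemma surplus_Suc: "surplus c (Suc k) = surplus c k + net c (Suc k)"
  by (simp add: surplus_def)

lemma net_waiting:
  assumes "\<not> match_pending I c" "waiting I c s k \<noteq> {}"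
  shows "net c k = psign s * int (card (waiting I c s k))" "0 < psign s * net c k"
proof -
  have "waiting I c s' k = {}" if "s' \<noteq> s" for s'
    using assms that unfolding match_pending_def by (cases s; cases s') blast+
  then show eq: "net c k = psign s * int (card (waiting I c s k))"
    by (cases s) (simp_all add: net_eq)
  have "0 < card (waiting I c s k)" using assms(2) by (simp add: card_gt_0_iff)
  then show "0 < psign s * net c k" unfolding eq by (cases s) simp_all
qed

lemma waiting_net: "0 < psign s * net c k \<Longrightarrow> waiting I c s k \<noteq> {}"
  by (cases s) (auto simp: net_eq)

lemma rate_eq:
  "rate \<alpha> I c s k = (if waiting I c s k \<noteq> {} \<and> 0 < psign s * surplus c k
     then \<alpha> k * \<bar>real_of_int (surplus c k)\<bar> else 0)"
  by (cases s) (auto simp: rate_def sur_eq)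

lemma rate_nonneg: "k \<in> pieces d \<Longrightarrow> 0 \<le> rate \<alpha> I c s k"
  using slope_pos[of k] by (simp add: rate_eq)

subsection \<open>Effect of the transitions\<close>

definition matched :: "config \<Rightarrow> nat \<Rightarrow> nat \<Rightarrow> config" where
  "matched c p q = c\<lparr>stat := (stat c)(p := Matched q (now c), q := Matched p (now c))\<rparr>"

definition moved :: "config \<Rightarrow> nat \<Rightarrow> nat \<Rightarrow> config" where
  "moved c k r = c\<lparr>stat := (stat c)(r := Waiting (Suc k)),
     counter := (\<lambda>s' j. if j = k then 0 else counter c s' j)\<rparr>"

definition arrived :: "config \<Rightarrow> nat \<Rightarrow> config" where
  "arrived c r = c\<lparr>stat := (stat c)(r := Waiting 1)\<rparr>"

lemma net_matched:
  assumes "p \<in> waiting I c Positive k" "q \<in> waiting I c Negative k"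
  shows "net (matched c p q) i = net c i"
proof -
  let ?h = "\<lambda>r s. if s = Waiting i then sg r else 0"
  have pq: "p \<in> R" "q \<in> R" "p \<noteq> q" "stat c p = Waiting k" "stat c q = Waiting k"
    "sg p = 1" "sg q = - 1"
    using assms by (auto simp: waiting_def)
  have "net (matched c p q) i =
      (\<Sum>r\<in>R. ?h r (((stat c)(p := Matched q (now c), q := Matched p (now c))) r))"
    by (simp add: net_def matched_def)
  also have "\<dots> = net c i"
    using pq unfolding sum_fun_upd[OF finite_R pq(2), of ?h] sum_fun_upd[OF finite_R pq(1), of ?h]
    by (simp add: net_def)
  finally show ?thesis .
qed

lemma net_moved:
  assumes "r \<in> waiting I c s k"
  shows "net (moved c k r) i = net c i - (if i = k then psign s else 0) + (if i = Suc k then psign s else 0)"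
proof -
  let ?h = "\<lambda>r s. if s = Waiting i then sg r else 0"
  have r: "r \<in> R" "stat c r = Waiting k" "polarity I r = s" using assms by (auto simp: waiting_def)
  have "net (moved c k r) i = (\<Sum>q\<in>R. ?h q (((stat c)(r := Waiting (Suc k))) q))"
    by (simp add: net_def moved_def)
  then show ?thesis using r unfolding sum_fun_upd[OF finite_R r(1), of ?h] by (auto simp: net_def)
qed

lemma net_arrived:
  assumes "r \<in> R" "stat c r = Unarrived"
  shows "net (arrived c r) i = net c i + (if i = 1 then sg r else 0)"
proof -
  let ?h = "\<lambda>r s. if s = Waiting i then sg r else 0"
  have "net (arrived c r) i = (\<Sum>q\<in>R. ?h q (((stat c)(r := Waiting 1)) q))"
    by (simp add: net_def arrived_def)
  then show ?thesis using assms unfolding sum_fun_upd[OF finite_R assms(1), of ?h] by (auto simp: net_def)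
qed

lemma surplus_matched:
  "p \<in> waiting I c Positive k \<Longrightarrow> q \<in> waiting I c Negative k \<Longrightarrow> surplus (matched c p q) i = surplus c i"
  unfolding surplus_def by (simp add: net_matched)

text \<open>The request leaves level \<open>k\<close> and enters \<open>Suc k\<close>; every prefix
  other than the one ending at \<open>k\<close> sees both changes or neither.\<close>

lemma surplus_moved:
  assumes "r \<in> waiting I c s k" "1 \<le> k"
  shows "surplus (moved c k r) i = surplus c i - (if i = k then psign s else 0)"
  using assms(2) unfolding surplus_def net_moved[OF assms(1)] sum.distrib sum_subtractf
  by (auto simp: sum.delta)

lemma surplus_arrived:
  assumes "r \<in> R" "stat c r = Unarrived" "1 \<le> i"
  shows "surplus (arrived c r) i = surplus c i + sg r"
  using assms(3) unfolding surplus_def net_arrived[OF assms(1,2)] sum.distrib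
  by (auto simp: sum.delta)

lemma net_elapse [simp]: "net (elapse \<alpha> I \<delta> c) i = net c i"
  and surplus_elapse [simp]: "surplus (elapse \<alpha> I \<delta> c) i = surplus c i"
  and target_elapse [simp]: "target (elapse \<alpha> I \<delta> c) i = target c i"
  and offset_elapse [simp]: "offset (elapse \<alpha> I \<delta> c) i = offset c i"
  by (simp_all add: elapse_def net_def surplus_def target_def offset_def)

lemma target_matched:
  assumes "p \<in> waiting I c Positive k" "q \<in> waiting I c Negative k"
  shows "target (matched c p q) i = target c i"
  using assms unfolding target_def by (intro sum.cong) (auto simp: matched_def waiting_def)

lemma target_moved: "r \<in> waiting I c s k \<Longrightarrow> target (moved c k r) i = target c i"
  unfolding target_def by (intro sum.cong) (auto simp: moved_def waiting_def)

lemma target_arrived: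
  assumes "r \<in> R" "stat c r = Unarrived"
  shows "target (arrived c r) i = target c i + (if ereal (gap r) < x i then sg r else 0)"
proof -
  let ?h = "\<lambda>r s. if s \<noteq> Unarrived \<and> ereal (gap r) < x i then sg r else 0"
  have "target (arrived c r) i = (\<Sum>q\<in>R. ?h q (((stat c)(r := Waiting 1)) q))"
    by (simp add: target_def arrived_def)
  then show ?thesis using assms unfolding sum_fun_upd[OF finite_R assms(1), of ?h] by (auto simp: target_def)
qed

lemma offset_matched:
  "p \<in> waiting I c Positive k \<Longrightarrow> q \<in> waiting I c Negative k \<Longrightarrow> offset (matched c p q) i = offset c i"
  by (simp add: offset_def surplus_matched target_matched)

lemma offset_moved:
  "r \<in> waiting I c s k \<Longrightarrow> 1 \<le> k \<Longrightarrow> offset (moved c k r) i = offset c i - (if i = k then psign s else 0)"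
  by (simp add: offset_def surplus_moved target_moved)

text \<open>An arrival enters the surplus of every level at once, and also the target of each level
  whose breakpoint exceeds its gap. Only the remaining levels notice it.\<close>

lemma offset_arrived:
  "r \<in> R \<Longrightarrow> stat c r = Unarrived \<Longrightarrow> 1 \<le> i \<Longrightarrow>
    offset (arrived c r) i = offset c i + (if x i \<le> ereal (gap r) then sg r else 0)"
  by (auto simp: offset_def surplus_arrived target_arrived)

subsection \<open>Consistent configurations\<close>

definition timely :: "config \<Rightarrow> bool" where
  "timely c \<longleftrightarrow> (\<forall>r\<in>R. if stat c r = Unarrived then now c \<le> arrival I r else arrival I r \<le> now c)"

definition levels_ok :: "config \<Rightarrow> bool" where
  "levels_ok c \<longleftrightarrow> (\<forall>r\<in>R. \<forall>j. stat c r = Waiting j \<longrightarrow> j \<in> pieces d)"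

definition matching_ok :: "config \<Rightarrow> bool" where
  "matching_ok c \<longleftrightarrow> (\<forall>r\<in>R. \<forall>q t. stat c r = Matched q t \<longrightarrow>
     q \<in> R \<and> polarity I q \<noteq> polarity I r \<and> stat c q = Matched r t \<and> arrival I r \<le> t)"

definition counters_ok :: "config \<Rightarrow> bool" where
  "counters_ok c \<longleftrightarrow>
     (\<forall>s. \<forall>k\<in>pieces d. 0 \<le> counter c s k \<and> ereal (counter c s k) \<le> capacity x \<alpha> k)"

text \<open>Several counters may be full at the same instant. The bound on \<open>net\<close> keeps a request
  available for each of them, even when a simultaneous move from the level below with the
  opposite polarity takes one away.\<close>

definition full_ok :: "config \<Rightarrow> bool" where
  "full_ok c \<longleftrightarrow> (\<forall>s k. full d x \<alpha> c s k \<longrightarrow> 0 < psign s * surplus c k \<and> 0 < psign s * net c k)"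

text \<open>An unbounded last level never overflows and no gap reaches its breakpoint, so its offset
  stays 0. This makes its potential nonnegative, and it shows that no surplus is left there once all
  requests have arrived.\<close>

definition last_ok :: "config \<Rightarrow> bool" where
  "last_ok c \<longleftrightarrow> (\<forall>k. d = enat k \<longrightarrow> offset c k = 0)"

definition consistent :: "config \<Rightarrow> bool" where
  "consistent c \<longleftrightarrow>
     timely c \<and> levels_ok c \<and> matching_ok c \<and> counters_ok c \<and> full_ok c \<and> last_ok c"

lemma not_full_0: "full d x \<alpha> c s k \<Longrightarrow> counter c s k \<noteq> 0"
  using capacity_pos[of k] unfolding full_def by (metis less_irrefl zero_ereal_def)

lemma capacity_ge_0: "k \<in> pieces d \<Longrightarrow> ereal 0 \<le> capacity x \<alpha> k"
  using capacity_pos[of k] by (metis less_imp_le zero_ereal_def)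

lemma full_not_last: "full d x \<alpha> c s k \<Longrightarrow> k \<in> pieces d \<and> d \<noteq> enat k \<and> counter c s k = Y k"
  using capacity_last[of k] capacity_finite[of k] by (cases "d = enat k") (auto simp: full_def)

lemma consistent_initial: "consistent initial"
proof -
  have "timely initial" using valid by (auto simp: timely_def initial_def valid_instance_def)
  moreover have "counters_ok initial"
    using capacity_ge_0 by (auto simp: counters_ok_def initial_def)
  moreover have "full_ok initial"
    using not_full_0[of initial] by (auto simp: full_ok_def initial_def)
  ultimately show ?thesis
    by (auto simp: consistent_def levels_ok_def matching_ok_def last_ok_def initial_def offset_def
        surplus_def net_def target_def)
qed

lemma consistent_matched:
  assumes c: "consistent c" and pq: "p \<in> waiting I c Positive k" "q \<in> waiting I c Negative k"
  shows "consistent (matched c p q)"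
proof -
  let ?c = "matched c p q"
  have *: "p \<in> R" "q \<in> R" "p \<noteq> q" "stat c p = Waiting k" "stat c q = Waiting k"
    "polarity I p = Positive" "polarity I q = Negative"
    using pq by (auto simp: waiting_def)
  have "timely ?c" using c * by (auto simp: consistent_def timely_def matched_def)
  moreover have "levels_ok ?c" using c * by (auto simp: consistent_def levels_ok_def matched_def)
  moreover have "counters_ok ?c" using c by (auto simp: consistent_def counters_ok_def matched_def)
  moreover have "full_ok ?c"
    using c by (auto simp: consistent_def full_ok_def net_matched[OF pq] surplus_matched[OF pq])
      (auto simp: matched_def full_def)
  moreover have "last_ok ?c" using c by (auto simp: consistent_def last_ok_def offset_matched[OF pq])
  moreover have "matching_ok ?c"
    unfolding matching_ok_def
  proof (intro ballI allI impI)
    fix r r' t assume r: "r \<in> R" "stat ?c r = Matched r' t"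
    have ap: "arrival I p \<le> now c" "arrival I q \<le> now c"
      using c * by (auto simp: consistent_def timely_def split: if_splits)
    consider "r = p" | "r = q" | "r \<noteq> p" "r \<noteq> q" by blast
    then show "r' \<in> R \<and> polarity I r' \<noteq> polarity I r \<and> stat ?c r' = Matched r t \<and> arrival I r \<le> t"
    proof cases
      case 3
      then have "stat c r = Matched r' t" using r by (simp add: matched_def)
      then have "r' \<in> R \<and> polarity I r' \<noteq> polarity I r \<and> stat c r' = Matched r t \<and> arrival I r \<le> t"
        using c r(1) unfolding consistent_def matching_ok_def by blast
      moreover from this have "r' \<noteq> p" "r' \<noteq> q" using * by auto
      ultimately show ?thesis by (simp add: matched_def)
    qed (use r * ap in \<open>auto simp: matched_def\<close>)
  qed
  ultimately show ?thesis by (simp add: consistent_def)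
qed

lemma consistent_moved:
  assumes c: "consistent c" and k: "full d x \<alpha> c s k" and r: "r \<in> waiting I c s k"
  shows "consistent (moved c k r)"
proof -
  let ?c = "moved c k r"
  have *: "r \<in> R" "stat c r = Waiting k" using r by (auto simp: waiting_def)
  have kd: "k \<in> pieces d" "d \<noteq> enat k" "1 \<le> k" using full_not_last[OF k] piecesD by auto
  then have Sk: "Suc k \<in> pieces d" by (cases d) (auto simp: pieces_def)
  have "timely ?c" using c * by (auto simp: consistent_def timely_def moved_def split: if_splits)
  moreover have "levels_ok ?c" using c * Sk by (auto simp: consistent_def levels_ok_def moved_def)
  moreover have "counters_ok ?c" using c capacity_ge_0
    by (auto simp: consistent_def counters_ok_def moved_def)
  moreover have "last_ok ?c" using c kd by (auto simp: consistent_def last_ok_def offset_moved[OF r])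
  moreover have "full_ok ?c"
    unfolding full_ok_def
  proof (intro allI impI)
    fix s' i assume f: "full d x \<alpha> ?c s' i"
    have ik: "i \<noteq> k" using not_full_0[OF f] by (auto simp: moved_def)
    then have "full d x \<alpha> c s' i" using f by (auto simp: full_def moved_def)
    then have pos: "0 < psign s' * surplus c i \<and> 0 < psign s' * net c i"
      using c by (simp add: consistent_def full_ok_def)
    have posk: "0 < psign s * surplus c k" using c k by (simp add: consistent_def full_ok_def)
    have "0 < psign s' * net ?c i"
    \<comment> \<open>For opposite polarities the surplus of level \<open>k\<close> has the sign of
      \<open>s\<close>, while that of \<open>Suc k\<close> has the sign of \<open>s'\<close>. Their
      difference is the net at \<open>Suc k\<close>, which is therefore at least 2 in the direction
      of \<open>s'\<close> and survives the loss of one.\<close>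
    proof (cases "i = Suc k")
      case True
      then show ?thesis using pos posk surplus_Suc[of c k]
        by (cases s; cases s') (auto simp: net_moved[OF r])
    qed (use ik pos in \<open>simp add: net_moved[OF r]\<close>)
    then show "0 < psign s' * surplus ?c i \<and> 0 < psign s' * net ?c i"
      using pos ik surplus_moved[OF r kd(3)] by simp
  qed
  moreover have "matching_ok ?c"
  proof -
    have "stat ?c q = Matched q' t \<longleftrightarrow> stat c q = Matched q' t" for q q' t
      using * by (auto simp: moved_def)
    then have "matching_ok ?c \<longleftrightarrow> matching_ok c" unfolding matching_ok_def by (simp only:)
    then show ?thesis using c by (simp add: consistent_def)
  qed
  ultimately show ?thesis by (simp add: consistent_def)
qed

lemma consistent_arrived:
  assumes c: "consistent c" and nf: "\<nexists>s k. full d x \<alpha> c s k"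
    and r: "r \<in> R" "stat c r = Unarrived" "arrival I r = now c"
  shows "consistent (arrived c r)"
proof -
  let ?c = "arrived c r"
  have "timely ?c" using c r by (auto simp: consistent_def timely_def arrived_def split: if_splits)
  moreover have "levels_ok ?c" using c r one_in_pieces
    by (auto simp: consistent_def levels_ok_def arrived_def)
  moreover have "counters_ok ?c" using c by (simp add: consistent_def counters_ok_def arrived_def)
  \<comment> \<open>Vacuous, since moves precede arrivals; otherwise an arrival could cancel the
    surplus of a full counter.\<close>
  moreover have "full_ok ?c" using nf by (auto simp: full_ok_def arrived_def full_def)
  moreover have "last_ok ?c"
    unfolding last_ok_def
  proof (intro allI impI)
    fix k assume d: "d = enat k"
    then have k: "k \<in> pieces d" using one_in_pieces by (auto simp: pieces_def)
    have "offset c k = 0" using c d unfolding consistent_def last_ok_def by blast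
    moreover have "x k = \<infinity>" using x_infinite_iff[OF k] d by blast
    ultimately show "offset ?c k = 0"
      using offset_arrived[OF r(1,2) piecesD[OF k]] by simp
  qed
  moreover have "matching_ok ?c"
  proof -
    have "stat ?c q = Matched q' t \<longleftrightarrow> stat c q = Matched q' t" for q q' t
      using r by (auto simp: arrived_def)
    then have "matching_ok ?c \<longleftrightarrow> matching_ok c" unfolding matching_ok_def by (simp only:)
    then show ?thesis using c by (simp add: consistent_def)
  qed
  ultimately show ?thesis by (simp add: consistent_def)
qed

lemma consistent_elapse:
  assumes c: "consistent c" and nm: "\<not> match_pending I c" and nf: "\<nexists>s k. full d x \<alpha> c s k"
    and \<delta>: "0 < \<delta>" "\<forall>r\<in>R. stat c r = Unarrived \<longrightarrow> now c + \<delta> \<le> arrival I r"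
      "\<forall>s. \<forall>k\<in>pieces d. ereal (counter (elapse \<alpha> I \<delta> c) s k) \<le> capacity x \<alpha> k"
  shows "consistent (elapse \<alpha> I \<delta> c)"
proof -
  let ?c = "elapse \<alpha> I \<delta> c"
  have stat: "stat ?c = stat c" by (simp add: elapse_def)
  have "timely ?c" using c \<delta> by (auto simp: consistent_def timely_def elapse_def split: if_splits)
  moreover have "levels_ok ?c" using c by (simp add: consistent_def levels_ok_def stat)
  moreover have "matching_ok ?c" using c unfolding consistent_def matching_ok_def stat by (elim conjE)
  moreover have "last_ok ?c" using c by (simp add: consistent_def last_ok_def)
  moreover have "counters_ok ?c"
    using c \<delta> rate_nonneg by (auto simp: consistent_def counters_ok_def elapse_def)
  moreover have "full_ok ?c"
    unfolding full_ok_def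
  proof (intro allI impI)
    fix s k assume "full d x \<alpha> ?c s k"
    moreover have "\<not> full d x \<alpha> c s k" using nf by blast
    \<comment> \<open>A counter that has just become full was rising, so it had a waiting request
      and a surplus of its own sign.\<close>
    ultimately have "rate \<alpha> I c s k \<noteq> 0" by (auto simp: full_def elapse_def)
    then have "waiting I c s k \<noteq> {}" "0 < psign s * surplus c k"
      by (auto simp: rate_eq split: if_splits)
    then show "0 < psign s * surplus ?c k \<and> 0 < psign s * net ?c k"
      using net_waiting[OF nm] by simp
  qed
  ultimately show ?thesis by (simp add: consistent_def)
qed

lemma consistent_step:
  assumes "consistent c" "bpsla_step d x \<alpha> I c c'"
  shows "consistent c'"
  using assms(2)
proof cases
  case (match p k q)
  then show ?thesis using consistent_matched[OF assms(1)] by (simp add: matched_def)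
next
  case (move s k r)
  then show ?thesis using consistent_moved[OF assms(1)] by (simp add: moved_def)
next
  case (arrive r)
  then show ?thesis using consistent_arrived[OF assms(1)] by (simp add: arrived_def)
next
  case (wait \<delta>)
  then show ?thesis using consistent_elapse[OF assms(1)] by simp
qed

subsection \<open>The amortised cost bound\<close>

text \<open>A request may reach level \<open>j\<close> while its age is still below
  \<open>X (j - 1)\<close>. Charging at least \<open>f (X (j - 1))\<close> limits the growth of the
  charge to the slope of level \<open>j\<close>, and it makes high levels expensive, which
  termination relies on.\<close>

definition request_cost :: "real \<Rightarrow> nat \<Rightarrow> status \<Rightarrow> real" where
  "request_cost T r s = (case s of
     Unarrived \<Rightarrow> 0
   | Waiting j \<Rightarrow> max (f (T - arrival I r)) (f (X (j - 1)))
   | Matched q t \<Rightarrow> f (t - arrival I r))"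

definition alg_cost :: "config \<Rightarrow> real" where
  "alg_cost c = (\<Sum>r\<in>R. request_cost (now c) r (stat c r))"

text \<open>Capping at the gap keeps the final total at \<open>gap r\<close> per request, whichever
  partner arrives first.\<close>

definition elapsed :: "config \<Rightarrow> nat \<Rightarrow> real" where
  "elapsed c r = (if stat c r = Unarrived then 0 else min (now c - arrival I r) (gap r))"

definition opt_time :: "config \<Rightarrow> nat \<Rightarrow> real" where
  "opt_time c k = (\<Sum>r\<in>R. if ereal (gap r) < x k then \<alpha> k * elapsed c r else 0)"

definition opt_jumps :: "config \<Rightarrow> nat \<Rightarrow> real" where
  "opt_jumps c k = (\<Sum>r\<in>R. if stat c r \<noteq> Unarrived \<and> x k \<le> ereal (gap r) then Y k else 0)"

definition Phi :: "config \<Rightarrow> nat \<Rightarrow> real" where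
  "Phi c k = phi (Y k) (offset c k) (counter c Positive k) (counter c Negative k)"

text \<open>The cutoff \<open>K\<close> keeps the sums finite when there are infinitely many pieces.
  The factors 11 and 24 come from \<open>phi_rise\<close> and \<open>phi_jump\<close>.\<close>

definition amortised :: "nat \<Rightarrow> config \<Rightarrow> bool" where
  "amortised K c \<longleftrightarrow> alg_cost c + (\<Sum>k=1..K. Phi c k) \<le>
     11 * (\<Sum>k=1..K. opt_time c k) + 24 * (\<Sum>k=1..K. opt_jumps c k)"

lemma counter_bounds:
  assumes "consistent c" "k \<in> pieces d"
  shows "0 \<le> counter c s k" "d \<noteq> enat k \<Longrightarrow> counter c s k \<le> Y k"
  using assms capacity_finite[of k] by (force simp: consistent_def counters_ok_def)+

lemma Phi_nonneg:
  assumes c: "consistent c" and k: "k \<in> pieces d"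
  shows "0 \<le> Phi c k"
proof -
  have "d \<noteq> enat k" if "offset c k \<noteq> 0"
    using c that by (auto simp: consistent_def last_ok_def)
  then show ?thesis
    unfolding Phi_def by (intro phi_nonneg counter_bounds[OF c k] conjI) blast+
qed

text \<open>If no counter of level \<open>k\<close> rises although the surplus up to \<open>k\<close> is nonzero, then the surplus up
  to \<open>k - 1\<close> is at least as large, at twice the slope. Hence the rising counters dominate.\<close>

lemma surplus_le_rates:
  assumes k: "Suc k \<in> pieces d"
  shows "\<alpha> (Suc k) * \<bar>real_of_int (surplus c (Suc k))\<bar> \<le>
     (rate \<alpha> I c Positive (Suc k) + rate \<alpha> I c Negative (Suc k)) + \<alpha> (Suc k) * \<bar>real_of_int (surplus c k)\<bar>"
proof -
  let ?k = "Suc k"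
  have a: "0 < \<alpha> ?k" using slope_pos[OF k] .
  have r0: "0 \<le> rate \<alpha> I c Positive ?k" "0 \<le> rate \<alpha> I c Negative ?k"
    using rate_nonneg[OF k] by auto
  have s: "surplus c ?k = surplus c k + net c ?k" by (rule surplus_Suc)
  have le: ?thesis if "\<bar>surplus c ?k\<bar> \<le> \<bar>surplus c k\<bar>"
  proof -
    have "\<bar>real_of_int (surplus c ?k)\<bar> \<le> \<bar>real_of_int (surplus c k)\<bar>" using that by linarith
    then have "\<alpha> ?k * \<bar>real_of_int (surplus c ?k)\<bar> \<le> \<alpha> ?k * \<bar>real_of_int (surplus c k)\<bar>"
      using a by (intro mult_left_mono) auto
    then show ?thesis using r0 by linarith
  qed
  have active: ?thesis if "waiting I c t ?k \<noteq> {}" "0 < psign t * surplus c ?k" for t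
  proof -
    have "\<alpha> ?k * \<bar>real_of_int (surplus c ?k)\<bar> = rate \<alpha> I c t ?k" using that by (simp add: rate_eq)
    also have "\<dots> \<le> rate \<alpha> I c Positive ?k + rate \<alpha> I c Negative ?k" using r0 by (cases t) auto
    also have "\<dots> \<le> rate \<alpha> I c Positive ?k + rate \<alpha> I c Negative ?k + \<alpha> ?k * \<bar>real_of_int (surplus c k)\<bar>"
      using a by simp
    finally show ?thesis .
  qed
  consider "surplus c ?k = 0" | t where "0 < psign t * surplus c ?k"
    by (metis linorder_neqE_linordered_idom mult_1 mult_minus1 neg_0_less_iff_less psign_simps)
  then show ?thesis
  proof cases
    case 1
    then show ?thesis using le by simp
  next
    case 2
    show ?thesis
    proof (cases "waiting I c t ?k = {}")
      case True
      then have "psign t * net c ?k \<le> 0" by (cases t) (auto simp: net_eq)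
      then have "\<bar>surplus c ?k\<bar> \<le> \<bar>surplus c k\<bar>" using 2 s by (cases t) auto
      then show ?thesis by (rule le)
    qed (use active 2 in blast)
  qed
qed

text \<open>Since slopes halve, \<open>\<alpha> (Suc k) * S k\<close> is at most half of
  \<open>\<alpha> k * S k\<close>. With \<open>surplus_le_rates\<close> the sum of the
  \<open>\<alpha> k * S k\<close> is thus at most twice the total rate, and bounding each net by two
  consecutive surpluses costs another factor 3/2. The extra terms \<open>\<alpha> K * S K\<close>
  carry the geometric loss through the induction.\<close>

lemma net_le_rates:
  assumes "K \<in> pieces d"
  shows "(\<Sum>k=1..K. \<alpha> k * \<bar>real_of_int (net c k)\<bar>)
    \<le> 3 * (\<Sum>k=1..K. rate \<alpha> I c Positive k + rate \<alpha> I c Negative k)"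
proof -
  define S where "S k = \<bar>real_of_int (surplus c k)\<bar>" for k
  define \<rho> where "\<rho> k = rate \<alpha> I c Positive k + rate \<alpha> I c Negative k" for k
  have "(\<Sum>k=1..K. \<alpha> k * S k) + \<alpha> K * S K \<le> 2 * (\<Sum>k=1..K. \<rho> k) \<and>
    2 * (\<Sum>k=1..K. \<alpha> k * \<bar>real_of_int (net c k)\<bar>) + \<alpha> K * S K \<le> 3 * (\<Sum>k=1..K. \<alpha> k * S k)"
    using piecesD[OF assms] assms
  proof (induction K rule: dec_induct)
    case base
    have "\<alpha> 1 * S 1 \<le> \<rho> 1" using surplus_le_rates[of 0 c] base by (simp add: S_def \<rho>_def surplus_def)
    moreover have "\<bar>real_of_int (net c 1)\<bar> = S 1" by (simp add: S_def surplus_def)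
    ultimately show ?case by (simp add: algebra_simps)
  next
    case (step k)
    have k: "k \<in> pieces d" using pieces_le[OF step.prems, of k] step.hyps by simp
    let ?k = "Suc k"
    have a: "0 < \<alpha> ?k" using slope_pos[OF step.prems] .
    have "2 * \<alpha> ?k * S k \<le> \<alpha> k * S k"
      using slope_halves[OF _ step.prems] step.hyps by (intro mult_right_mono) (auto simp: S_def)
    moreover have "\<alpha> ?k * S ?k \<le> \<rho> ?k + \<alpha> ?k * S k"
      using surplus_le_rates[OF step.prems] by (simp add: S_def \<rho>_def)
    moreover have "\<alpha> ?k * \<bar>real_of_int (net c ?k)\<bar> \<le> \<alpha> ?k * (S ?k + S k)"
      using a by (intro mult_left_mono) (auto simp: S_def surplus_Suc)
    then have "\<alpha> ?k * \<bar>real_of_int (net c ?k)\<bar> \<le> \<alpha> ?k * S ?k + \<alpha> ?k * S k" by (simp add: algebra_simps)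
    ultimately show ?case using step.IH[OF k] step.hyps by (simp add: algebra_simps)
  qed
  moreover have "0 \<le> \<alpha> K * S K" using slope_pos[OF assms] by (simp add: S_def)
  ultimately show ?thesis unfolding \<rho>_def by linarith
qed

text \<open>Without a pending match all requests at one level have the same polarity, so nothing
  cancels.\<close>

lemma abs_net:
  assumes "\<not> match_pending I c"
  shows "\<bar>real_of_int (net c k)\<bar> = (\<Sum>r\<in>R. if stat c r = Waiting k then 1 else 0)"
proof -
  have "{r \<in> R. stat c r = Waiting k} = waiting I c Positive k \<union> waiting I c Negative k"
    using polarity.exhaust by (auto simp: waiting_def)
  moreover have "waiting I c Positive k = {} \<or> waiting I c Negative k = {}"
    using assms by (auto simp: match_pending_def)
  ultimately have "\<bar>net c k\<bar> = int (card {r \<in> R. stat c r = Waiting k})"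
    by (auto simp: net_eq)
  then have "\<bar>real_of_int (net c k)\<bar> = real (card {r \<in> R. stat c r = Waiting k})" by linarith
  then show ?thesis by (simp add: sum.If_cases Int_def)
qed

lemma waiting_slopes_eq:
  assumes "\<not> match_pending I c" "\<And>r j. r \<in> R \<Longrightarrow> stat c r = Waiting j \<Longrightarrow> 1 \<le> j \<and> j \<le> K"
  shows "(\<Sum>r\<in>R. case stat c r of Waiting j \<Rightarrow> \<alpha> j | _ \<Rightarrow> 0) = (\<Sum>k=1..K. \<alpha> k * \<bar>real_of_int (net c k)\<bar>)"
proof -
  have "(\<Sum>k=1..K. \<alpha> k * \<bar>real_of_int (net c k)\<bar>) =
      (\<Sum>k=1..K. \<Sum>r\<in>R. if stat c r = Waiting k then \<alpha> k else 0)"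
    unfolding abs_net[OF assms(1)] sum_distrib_left by (intro sum.cong) auto
  also have "\<dots> = (\<Sum>r\<in>R. \<Sum>k=1..K. if stat c r = Waiting k then \<alpha> k else 0)" by (rule sum.swap)
  also have "\<dots> = (\<Sum>r\<in>R. case stat c r of Waiting j \<Rightarrow> \<alpha> j | _ \<Rightarrow> 0)"
  proof (intro sum.cong refl)
    fix r assume r: "r \<in> R"
    show "(\<Sum>k=1..K. if stat c r = Waiting k then \<alpha> k else 0) = (case stat c r of Waiting j \<Rightarrow> \<alpha> j | _ \<Rightarrow> 0)"
    proof (cases "stat c r")
      case (Waiting j)
      then show ?thesis using assms(2)[OF r Waiting] by simp
    qed simp_all
  qed
  finally show ?thesis by simp
qed

text \<open>Requests whose partner has arrived cancel, so only the requests for which the offline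
  solution is certainly still paying contribute.\<close>

lemma target_le:
  "\<bar>real_of_int (target c k)\<bar> \<le>
    (\<Sum>r\<in>R. if stat c r \<noteq> Unarrived \<and> stat c (\<pi> r) = Unarrived \<and> ereal (gap r) < x k then 1 else 0)"
proof -
  let ?A = "\<lambda>r. if stat c r \<noteq> Unarrived \<and> stat c (\<pi> r) \<noteq> Unarrived \<and> ereal (gap r) < x k then sg r else 0"
  let ?B = "\<lambda>r. if stat c r \<noteq> Unarrived \<and> stat c (\<pi> r) = Unarrived \<and> ereal (gap r) < x k then sg r else 0"
  have "(\<Sum>r\<in>R. ?A r) = 0"
    using \<pi>_polarity polarity_neq by (intro sum_closed_eq_0) (auto simp: \<pi>_\<pi> gap_\<pi>)
  moreover have "target c k = (\<Sum>r\<in>R. ?A r) + (\<Sum>r\<in>R. ?B r)"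
    unfolding target_def sum.distrib[symmetric] by (intro sum.cong) auto
  ultimately have "\<bar>target c k\<bar> \<le> (\<Sum>r\<in>R. \<bar>?B r\<bar>)" by (simp add: sum_abs)
  also have "\<dots> = (\<Sum>r\<in>R. if stat c r \<noteq> Unarrived \<and> stat c (\<pi> r) = Unarrived \<and> ereal (gap r) < x k then 1 else 0)"
    by (intro sum.cong) (auto simp: psign_def split: polarity.splits)
  finally have "real_of_int \<bar>target c k\<bar> \<le> real_of_int (\<Sum>r\<in>R. if stat c r \<noteq> Unarrived \<and> stat c (\<pi> r) = Unarrived \<and> ereal (gap r) < x k then 1 else 0)"
    by (simp only: of_int_le_iff)
  then show ?thesis by (simp add: of_int_sum if_distrib cong: if_cong)
qed

section \<open>Amortisation while time passes\<close>

lemma Phi_elapse: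
  assumes c: "consistent c" and k: "k \<in> pieces d" and \<delta>: "0 < \<delta>"
  shows "Phi (elapse \<alpha> I \<delta> c) k + 3 * \<delta> * (rate \<alpha> I c Positive k + rate \<alpha> I c Negative k)
    \<le> Phi c k + 11 * (\<delta> * (\<alpha> k * \<bar>real_of_int (target c k)\<bar>))"
proof -
  have a: "0 < \<alpha> k" using slope_pos[OF k] .
  define \<tau> where "\<tau> = \<delta> * (\<alpha> k * \<bar>real_of_int (target c k)\<bar>)"
  have \<tau>0: "0 \<le> \<tau>" using a \<delta> by (simp add: \<tau>_def)
  have h: "\<delta> * rate \<alpha> I c s k \<le> \<tau>" if "\<bar>surplus c k\<bar> \<le> \<bar>target c k\<bar>" for s
  proof -
    have "rate \<alpha> I c s k \<le> \<alpha> k * \<bar>real_of_int (surplus c k)\<bar>" using a by (simp add: rate_eq)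
    also have "\<dots> \<le> \<alpha> k * \<bar>real_of_int (target c k)\<bar>"
      using a that by (intro mult_left_mono) linarith+
    finally show ?thesis using \<delta> by (simp add: \<tau>_def mult_left_mono)
  qed
  have h0: "0 \<le> \<delta> * rate \<alpha> I c s k" for s using rate_nonneg[OF k] \<delta> by simp
  have e: "counter (elapse \<alpha> I \<delta> c) s k = counter c s k + \<delta> * rate \<alpha> I c s k" for s
    by (simp add: elapse_def)
  consider "surplus c k > 0" | "surplus c k < 0" | "surplus c k = 0" by linarith
  then show ?thesis
    unfolding \<tau>_def[symmetric]
  proof cases
    case 1
    then have "rate \<alpha> I c Negative k = 0" by (simp add: rate_eq)
    \<comment> \<open>Only the positive counter can rise here. If the offset is not positive, the
      target is at least the positive surplus, so the offline solution pays for the rise.\<close>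
    moreover have "11 * (\<delta> * rate \<alpha> I c Positive k) \<le> 11 * \<tau>" if "\<not> offset c k > 0"
      using h[of Positive] 1 that by (simp add: offset_def)
    ultimately show "Phi (elapse \<alpha> I \<delta> c) k + 3 * \<delta> * (rate \<alpha> I c Positive k + rate \<alpha> I c Negative k) \<le> Phi c k + 11 * \<tau>"
      using phi_rise[OF h0, of "Y k" "offset c k" "counter c Positive k" Positive "counter c Negative k"] \<tau>0
      unfolding Phi_def e by (cases "offset c k > 0") auto
  next
    case 2
    then have "rate \<alpha> I c Positive k = 0" by (simp add: rate_eq)
    moreover have "11 * (\<delta> * rate \<alpha> I c Negative k) \<le> 11 * \<tau>" if "\<not> offset c k < 0"
      using h[of Negative] 2 that by (simp add: offset_def)
    ultimately show "Phi (elapse \<alpha> I \<delta> c) k + 3 * \<delta> * (rate \<alpha> I c Positive k + rate \<alpha> I c Negative k) \<le> Phi c k + 11 * \<tau>"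
      using phi_rise_neg[OF h0, of "Y k" "offset c k" "counter c Positive k" "counter c Negative k" Negative] \<tau>0
      unfolding Phi_def e by (cases "offset c k < 0") auto
  next
    case 3
    then have "rate \<alpha> I c s k = 0" for s by (simp add: rate_eq)
    then show "Phi (elapse \<alpha> I \<delta> c) k + 3 * \<delta> * (rate \<alpha> I c Positive k + rate \<alpha> I c Negative k) \<le> Phi c k + 11 * \<tau>"
      unfolding Phi_def e using \<tau>0 by simp
  qed
qed

lemma opt_time_elapse:
  assumes c: "consistent c" and k: "k \<in> pieces d"
    and \<delta>: "0 < \<delta>" "\<forall>r\<in>R. stat c r = Unarrived \<longrightarrow> now c + \<delta> \<le> arrival I r"
  shows "opt_time c k + \<delta> * (\<alpha> k * \<bar>real_of_int (target c k)\<bar>) \<le> opt_time (elapse \<alpha> I \<delta> c) k"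
proof -
  let ?c = "elapse \<alpha> I \<delta> c"
  let ?P = "\<lambda>r. stat c r \<noteq> Unarrived \<and> stat c (\<pi> r) = Unarrived \<and> ereal (gap r) < x k"
  have a: "0 < \<alpha> k" using slope_pos[OF k] .
  have "\<delta> * (\<alpha> k * \<bar>real_of_int (target c k)\<bar>) \<le> \<delta> * (\<alpha> k * (\<Sum>r\<in>R. if ?P r then 1 else 0))"
    using target_le a \<delta> by (intro mult_left_mono) auto
  also have "\<dots> = (\<Sum>r\<in>R. if ?P r then \<alpha> k * \<delta> else 0)"
    unfolding sum_distrib_left by (intro sum.cong) auto
  finally have 1: "\<delta> * (\<alpha> k * \<bar>real_of_int (target c k)\<bar>) \<le> (\<Sum>r\<in>R. if ?P r then \<alpha> k * \<delta> else 0)" .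
  have "opt_time c k + (\<Sum>r\<in>R. if ?P r then \<alpha> k * \<delta> else 0) \<le> opt_time ?c k"
    unfolding opt_time_def sum.distrib[symmetric]
  proof (intro sum_mono)
    fix r assume r: "r \<in> R"
    have "elapsed c r + (if ?P r then \<delta> else 0) \<le> elapsed ?c r"
    proof (cases "?P r")
      case True
      \<comment> \<open>The partner does not arrive before the end of the interval, so the age of
        \<open>r\<close> stays within its gap and the cap is inactive.\<close>
      then have "arrival I r \<le> now c" "now c + \<delta> \<le> arrival I (\<pi> r)"
        using c \<delta> r \<pi>_in[OF r] by (auto simp: consistent_def timely_def)
      then show ?thesis using True \<delta> by (auto simp: elapsed_def elapse_def gap_def)
    next
      case False
      then show ?thesis using \<delta> unfolding elapsed_def elapse_def by auto
    qed
    then have "\<alpha> k * (elapsed c r + (if ?P r then \<delta> else 0)) \<le> \<alpha> k * elapsed ?c r"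
      using a by (intro mult_left_mono) auto
    then show "(if ereal (gap r) < x k then \<alpha> k * elapsed c r else 0) + (if ?P r then \<alpha> k * \<delta> else 0)
        \<le> (if ereal (gap r) < x k then \<alpha> k * elapsed ?c r else 0)"
      by (auto simp: algebra_simps split: if_splits)
  qed
  then show ?thesis using 1 by linarith
qed

lemma alg_cost_elapse:
  assumes c: "consistent c" and nm: "\<not> match_pending I c" and K: "K \<in> pieces d" and \<delta>: "0 < \<delta>"
    and lev: "\<And>r j. r \<in> R \<Longrightarrow> stat c r = Waiting j \<Longrightarrow> j \<le> K"
  shows "alg_cost (elapse \<alpha> I \<delta> c) \<le>
    alg_cost c + 3 * \<delta> * (\<Sum>k=1..K. rate \<alpha> I c Positive k + rate \<alpha> I c Negative k)"
proof -
  let ?c = "elapse \<alpha> I \<delta> c"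
  have p: "j \<in> pieces d" if "r \<in> R" "stat c r = Waiting j" for r j
    using c that by (auto simp: consistent_def levels_ok_def)
  have "alg_cost ?c \<le> (\<Sum>r\<in>R. request_cost (now c) r (stat c r) + \<delta> * (case stat c r of Waiting j \<Rightarrow> \<alpha> j | _ \<Rightarrow> 0))"
    unfolding alg_cost_def
  proof (intro sum_mono)
    fix r assume r: "r \<in> R"
    show "request_cost (now ?c) r (stat ?c r) \<le> request_cost (now c) r (stat c r) + \<delta> * (case stat c r of Waiting j \<Rightarrow> \<alpha> j | _ \<Rightarrow> 0)"
    proof (cases "stat c r")
      case (Waiting j)
      have "arrival I r \<le> now c" using c r Waiting by (auto simp: consistent_def timely_def split: if_splits)
      then have "max (f (now c - arrival I r + \<delta>)) (f (X (j - 1))) \<le> max (f (now c - arrival I r)) (f (X (j - 1))) + \<alpha> j * \<delta>"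
        using f_growth[OF p[OF r Waiting]] \<delta> by simp
      then show ?thesis using Waiting by (simp add: request_cost_def elapse_def algebra_simps)
    qed (simp_all add: request_cost_def elapse_def)
  qed
  also have "\<dots> = alg_cost c + \<delta> * (\<Sum>k=1..K. \<alpha> k * \<bar>real_of_int (net c k)\<bar>)"
    unfolding sum.distrib alg_cost_def sum_distrib_left[symmetric]
    using waiting_slopes_eq[OF nm, of K] p lev piecesD by simp
  also have "\<dots> \<le> alg_cost c + \<delta> * (3 * (\<Sum>k=1..K. rate \<alpha> I c Positive k + rate \<alpha> I c Negative k))"
    using net_le_rates[OF K] \<delta> by (intro add_left_mono mult_left_mono) auto
  finally show ?thesis by (simp add: algebra_simps)
qed

lemma amortised_elapse:
  assumes c: "consistent c" and nm: "\<not> match_pending I c" and K: "K \<in> pieces d"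
    and \<delta>: "0 < \<delta>" "\<forall>r\<in>R. stat c r = Unarrived \<longrightarrow> now c + \<delta> \<le> arrival I r"
    and lev: "\<And>r j. r \<in> R \<Longrightarrow> stat c r = Waiting j \<Longrightarrow> j \<le> K"
    and am: "amortised K c"
  shows "amortised K (elapse \<alpha> I \<delta> c)"
proof -
  let ?c = "elapse \<alpha> I \<delta> c"
  have p: "k \<in> pieces d" if "k \<in> {1..K}" for k using that pieces_le[OF K] by auto
  have "(\<Sum>k=1..K. Phi ?c k + 3 * \<delta> * (rate \<alpha> I c Positive k + rate \<alpha> I c Negative k)) \<le>
      (\<Sum>k=1..K. Phi c k + 11 * (\<delta> * (\<alpha> k * \<bar>real_of_int (target c k)\<bar>)))"
    using Phi_elapse[OF c p \<delta>(1)] by (intro sum_mono)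
  then have "(\<Sum>k=1..K. Phi ?c k) + 3 * \<delta> * (\<Sum>k=1..K. rate \<alpha> I c Positive k + rate \<alpha> I c Negative k) \<le>
      (\<Sum>k=1..K. Phi c k) + 11 * (\<Sum>k=1..K. \<delta> * (\<alpha> k * \<bar>real_of_int (target c k)\<bar>))"
    by (simp only: sum.distrib[of "Phi ?c"] sum.distrib[of "Phi c"] sum_distrib_left)
  moreover have "(\<Sum>k=1..K. opt_time c k + \<delta> * (\<alpha> k * \<bar>real_of_int (target c k)\<bar>)) \<le> (\<Sum>k=1..K. opt_time ?c k)"
    using opt_time_elapse[OF c p \<delta>] by (intro sum_mono)
  then have "(\<Sum>k=1..K. opt_time c k) + (\<Sum>k=1..K. \<delta> * (\<alpha> k * \<bar>real_of_int (target c k)\<bar>)) \<le> (\<Sum>k=1..K. opt_time ?c k)"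
    by (simp only: sum.distrib)
  moreover have "alg_cost ?c \<le> alg_cost c + 3 * \<delta> * (\<Sum>k=1..K. rate \<alpha> I c Positive k + rate \<alpha> I c Negative k)"
    by (rule alg_cost_elapse[OF c nm K \<delta>(1) lev])
  moreover have "opt_jumps ?c k = opt_jumps c k" for k by (simp add: opt_jumps_def elapse_def)
  ultimately show ?thesis using am unfolding amortised_def by simp
qed


section \<open>Amortisation at the start and at instantaneous transitions\<close>

lemma amortised_initial: "amortised K initial"
proof -
  have "alg_cost initial = 0" by (simp add: alg_cost_def initial_def request_cost_def)
  moreover have "Phi initial k = 0" for k
    by (simp add: Phi_def phi_def offset_def surplus_def net_def target_def initial_def)
  moreover have "opt_time initial k = 0" for k
    by (auto simp: opt_time_def elapsed_def initial_def intro!: sum.neutral)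
  moreover have "opt_jumps initial k = 0" for k by (simp add: opt_jumps_def initial_def)
  ultimately show ?thesis by (simp add: amortised_def)
qed

lemma amortised_matched:
  assumes pq: "p \<in> waiting I c Positive k" "q \<in> waiting I c Negative k" and am: "amortised K c"
  shows "amortised K (matched c p q)"
proof -
  let ?c = "matched c p q"
  have *: "p \<in> R" "q \<in> R" "p \<noteq> q" "stat c p = Waiting k" "stat c q = Waiting k"
    using pq by (auto simp: waiting_def)
  have "alg_cost ?c \<le> alg_cost c"
    unfolding alg_cost_def using * by (intro sum_mono) (auto simp: matched_def request_cost_def)
  moreover have "Phi ?c i = Phi c i" for i
    unfolding Phi_def offset_matched[OF pq] by (simp add: matched_def)
  moreover have "opt_time ?c i = opt_time c i" for i
    unfolding opt_time_def using * by (intro sum.cong) (auto simp: matched_def elapsed_def)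
  moreover have "opt_jumps ?c i = opt_jumps c i" for i
    unfolding opt_jumps_def using * by (intro sum.cong) (auto simp: matched_def)
  ultimately show ?thesis using am by (simp add: amortised_def)
qed

text \<open>The charge of the moved request rises by at most \<open>f (X k) - f (X (k - 1))\<close>,
  which is \<open>Y k\<close>, the amount that the potential of level \<open>k\<close> releases. All
  other levels keep their offset and counters.\<close>

lemma amortised_moved:
  assumes c: "consistent c" and k: "full d x \<alpha> c s k" and r: "r \<in> waiting I c s k"
    and kK: "k \<le> K" and am: "amortised K c"
  shows "amortised K (moved c k r)"
proof -
  let ?c = "moved c k r"
  have *: "r \<in> R" "stat c r = Waiting k" using r by (auto simp: waiting_def)
  have kd: "k \<in> pieces d" "d \<noteq> enat k" "counter c s k = Y k" "1 \<le> k"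
    using full_not_last[OF k] piecesD by auto
  let ?age = "now c - arrival I r"
  have "alg_cost ?c = (\<Sum>q\<in>R. request_cost (now c) q (((stat c)(r := Waiting (Suc k))) q))"
    by (simp add: alg_cost_def moved_def)
  also have "\<dots> = alg_cost c - max (f ?age) (f (X (k - 1))) + max (f ?age) (f (X k))"
    unfolding sum_fun_upd[OF finite_R *(1)] * by (simp add: alg_cost_def request_cost_def)
  finally have "alg_cost ?c \<le> alg_cost c + Y k"
    using f_breakpoint[OF kd(1,2)] Y_nonneg[OF kd(1)] by linarith
  moreover have Phi: "Phi ?c i + (if i = k then Y k else 0) \<le> Phi c i" for i
  proof (cases "i = k")
    case True
    have "phi (Y k) (offset c k - psign s) 0 0 + Y k \<le> Phi c k"
      using phi_move[of "counter c Negative k" "Y k" "offset c k"]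
        phi_move_neg[of "counter c Positive k" "Y k" "offset c k"]
        counter_bounds[OF c kd(1)] kd
      by (cases s) (auto simp: Phi_def)
    then show ?thesis using True by (simp add: Phi_def offset_moved[OF r kd(4)]) (simp add: moved_def)
  next
    case False
    then show ?thesis by (simp add: Phi_def offset_moved[OF r kd(4)]) (simp add: moved_def)
  qed
  have "(\<Sum>i=1..K. Phi ?c i + (if i = k then Y k else 0)) \<le> (\<Sum>i=1..K. Phi c i)"
    using Phi by (intro sum_mono)
  then have "(\<Sum>i=1..K. Phi ?c i) + Y k \<le> (\<Sum>i=1..K. Phi c i)"
    using kd kK by (simp add: sum.distrib)
  moreover have "opt_time ?c i = opt_time c i" for i
    unfolding opt_time_def using * by (intro sum.cong) (auto simp: moved_def elapsed_def)
  moreover have "opt_jumps ?c i = opt_jumps c i" for i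
    unfolding opt_jumps_def using * by (intro sum.cong) (auto simp: moved_def)
  ultimately show ?thesis using am by (simp add: amortised_def)
qed

lemma amortised_arrived:
  assumes c: "consistent c" and K: "K \<in> pieces d"
    and r: "r \<in> R" "stat c r = Unarrived" "arrival I r = now c" and am: "amortised K c"
  shows "amortised K (arrived c r)"
proof -
  let ?c = "arrived c r"
  let ?jump = "\<lambda>k. if x k \<le> ereal (gap r) then Y k else 0"
  have "alg_cost ?c = (\<Sum>q\<in>R. request_cost (now c) q (((stat c)(r := Waiting 1)) q))"
    by (simp add: alg_cost_def arrived_def)
  \<comment> \<open>The new request has age 0 and starts at level 1, so its charge is
    \<open>f 0\<close>.\<close>
  also have "\<dots> = alg_cost c"
    unfolding sum_fun_upd[OF finite_R r(1)] using r by (simp add: alg_cost_def request_cost_def)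
  finally have "alg_cost ?c = alg_cost c" .
  moreover have "(\<Sum>k=1..K. Phi ?c k) \<le> (\<Sum>k=1..K. Phi c k + 24 * ?jump k)"
  proof (rule sum_mono)
    fix k assume "k \<in> {1..K}"
    then have k: "k \<in> pieces d" "1 \<le> k" using pieces_le[OF K] by auto
    have ctr: "counter ?c = counter c" by (simp add: arrived_def)
    show "Phi ?c k \<le> Phi c k + 24 * ?jump k"
    proof (cases "x k \<le> ereal (gap r)")
      case True
      then have "d \<noteq> enat k" using x_infinite_iff[OF k(1)] by auto
      moreover have "\<bar>offset ?c k - offset c k\<bar> \<le> 1"
        using True offset_arrived[OF r(1,2) k(2)] by (cases "polarity I r") auto
      ultimately show ?thesis
        unfolding Phi_def ctr using True by (simp add: phi_jump counter_bounds[OF c k(1)])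
    next
      case False
      then show ?thesis using offset_arrived[OF r(1,2) k(2)] by (simp add: Phi_def ctr)
    qed
  qed
  moreover have "opt_time ?c k = opt_time c k" for k
    unfolding opt_time_def using r by (intro sum.cong) (auto simp: arrived_def elapsed_def)
  moreover have "opt_jumps ?c k = opt_jumps c k + ?jump k" for k
  proof -
    let ?h = "\<lambda>q s. if s \<noteq> Unarrived \<and> x k \<le> ereal (gap q) then Y k else 0"
    have "opt_jumps ?c k = (\<Sum>q\<in>R. ?h q (((stat c)(r := Waiting 1)) q))"
      by (simp add: opt_jumps_def arrived_def)
    then show ?thesis unfolding sum_fun_upd[OF finite_R r(1), of ?h] using r by (simp add: opt_jumps_def)
  qed
  ultimately show ?thesis using am by (simp add: amortised_def sum.distrib sum_distrib_left[symmetric])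
qed

lemma amortised_step:
  assumes c: "consistent c" and K: "K \<in> pieces d"
    and lev: "\<And>r j. r \<in> R \<Longrightarrow> stat c r = Waiting j \<Longrightarrow> j \<le> K"
    and am: "amortised K c" and step: "bpsla_step d x \<alpha> I c c'"
  shows "amortised K c'"
  using step
proof cases
  case (match p k q)
  then show ?thesis using amortised_matched[OF _ _ am] by (simp add: matched_def)
next
  case (move s k r)
  then have "k \<le> K" using lev[of r k] by (auto simp: waiting_def)
  then show ?thesis using amortised_moved[OF c move(3,4) _ am] move by (simp add: moved_def)
next
  case (arrive r)
  then show ?thesis using amortised_arrived[OF c K _ _ _ am] by (simp add: arrived_def)
next
  case (wait \<delta>)
  then show ?thesis using amortised_elapse[OF c _ K _ _ lev am] by simp
qed

text \<open>Exchanging the sums over levels and requests, each gap contributes at most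
  \<open>2 * f (gap r)\<close> to the time terms and \<open>f (gap r)\<close> to the jumps; 46 is 11
  * 2 + 24.\<close>

lemma amortised_alg_cost:
  assumes c: "consistent c" and K: "K \<in> pieces d" and am: "amortised K c"
  shows "alg_cost c \<le> 46 * (\<Sum>r\<in>R. f (gap r))"
proof -
  have p: "k \<in> pieces d" if "k \<in> {1..K}" for k using that pieces_le[OF K] by auto
  have "(\<Sum>k=1..K. opt_time c k) \<le> (\<Sum>k=1..K. \<Sum>r\<in>R. if ereal (gap r) < x k then \<alpha> k * gap r else 0)"
    unfolding opt_time_def using slope_pos[OF p]
    by (intro sum_mono) (auto simp: elapsed_def intro!: mult_left_mono less_imp_le)
  also have "\<dots> = (\<Sum>r\<in>R. \<Sum>k=1..K. if ereal (gap r) < x k then \<alpha> k * gap r else 0)"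
    by (rule sum.swap)
  also have "\<dots> \<le> (\<Sum>r\<in>R. 2 * f (gap r))"
    by (intro sum_mono sum_slopes_le K gap_nonneg)
  finally have time: "(\<Sum>k=1..K. opt_time c k) \<le> 2 * (\<Sum>r\<in>R. f (gap r))"
    by (simp only: sum_distrib_left)
  have "(\<Sum>k=1..K. opt_jumps c k) \<le> (\<Sum>k=1..K. \<Sum>r\<in>R. if x k \<le> ereal (gap r) then Y k else 0)"
    unfolding opt_jumps_def using Y_nonneg[OF p] by (intro sum_mono) auto
  also have "\<dots> = (\<Sum>r\<in>R. \<Sum>k=1..K. if x k \<le> ereal (gap r) then Y k else 0)"
    by (rule sum.swap)
  also have "\<dots> \<le> (\<Sum>r\<in>R. f (gap r))"
    by (intro sum_mono sum_capacities_le K gap_nonneg)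
  finally have jumps: "(\<Sum>k=1..K. opt_jumps c k) \<le> (\<Sum>r\<in>R. f (gap r))" .
  have "0 \<le> (\<Sum>k=1..K. Phi c k)" by (intro sum_nonneg Phi_nonneg[OF c p])
  then show ?thesis using am time jumps unfolding amortised_def by linarith
qed

subsection \<open>Termination\<close>

lemma run_consistent: "bpsla_run d x \<alpha> I run \<Longrightarrow> consistent (run n)"
proof (induction n)
  case 0
  then show ?case using consistent_initial by (simp add: bpsla_run_def)
next
  case (Suc n)
  then show ?case using consistent_step[of "run n" "run (Suc n)"] unfolding bpsla_run_def by metis
qed

text \<open>The first \<open>N\<close> steps use finitely many levels, so their maximum serves as
  cutoff. It depends on \<open>N\<close>, but the resulting bound does not.\<close>

lemma run_alg_cost:
  assumes run: "bpsla_run d x \<alpha> I run"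
  shows "alg_cost (run N) \<le> 46 * (\<Sum>r\<in>R. f (gap r))"
proof -
  note c = run_consistent[OF run]
  define L where "L = insert 1 ((\<lambda>(n, r). case stat (run n) r of Waiting j \<Rightarrow> j | _ \<Rightarrow> 1) ` ({..N} \<times> R))"
  have fin: "finite L" by (simp add: L_def)
  have sub: "L \<subseteq> pieces d"
    using c one_in_pieces unfolding L_def consistent_def levels_ok_def
    by (auto split: status.splits)
  have lev: "j \<le> Max L" if "n \<le> N" "r \<in> R" "stat (run n) r = Waiting j" for n r j
  proof -
    have "j \<in> L" unfolding L_def using that by (force intro!: image_eqI[of _ _ "(n, r)"])
    then show ?thesis using fin by simp
  qed
  have K: "Max L \<in> pieces d" using sub Max_in[OF fin] by (auto simp: L_def)
  have "amortised (Max L) (run n)" if "n \<le> N" for n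
    using that
  proof (induction n)
    case 0
    then show ?case using amortised_initial run by (simp add: bpsla_run_def)
  next
    case (Suc n)
    then have am: "amortised (Max L) (run n)" by simp
    have "bpsla_step d x \<alpha> I (run n) (run (Suc n)) \<or> run (Suc n) = run n"
      using run by (auto simp: bpsla_run_def)
    then show ?case
      using amortised_step[OF c K lev[of n] am] am Suc.prems by fastforce
  qed
  then show ?thesis using amortised_alg_cost[OF c K] by blast
qed

lemma request_cost_nonneg: "consistent c \<Longrightarrow> r \<in> R \<Longrightarrow> 0 \<le> request_cost (now c) r (stat c r)"
proof (cases "stat c r")
  case (Waiting j)
  assume "consistent c" "r \<in> R"
  then have "arrival I r \<le> now c" using Waiting by (auto simp: consistent_def timely_def split: if_splits)
  then show ?thesis using Waiting f_nonneg by (simp add: request_cost_def le_max_iff_disj)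
next
  case (Matched q t)
  assume "consistent c" "r \<in> R"
  then have "arrival I r \<le> t" using Matched unfolding consistent_def matching_ok_def by blast
  then show ?thesis using Matched f_nonneg by (simp add: request_cost_def)
qed (simp add: request_cost_def)

text \<open>A request at level \<open>j\<close> is charged at least \<open>f (X (j - 1))\<close>,
  which exceeds \<open>B\<close> once that breakpoint has passed \<open>t\<close>.\<close>

lemma levels_bounded:
  assumes "0 \<le> t" "B < f t"
  shows "\<exists>J. \<forall>c r j. consistent c \<longrightarrow> alg_cost c \<le> B \<longrightarrow> r \<in> R \<longrightarrow> stat c r = Waiting j \<longrightarrow> j \<le> J"
proof -
  obtain k where k: "k \<in> pieces d" "ereal t \<le> x k" by (rule piece_above[of 0 t]) blast
  have "j \<le> k" if c: "consistent c" "alg_cost c \<le> B" and r: "r \<in> R" "stat c r = Waiting j" for c r j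
  proof (rule ccontr)
    assume jk: "\<not> j \<le> k"
    have j: "j \<in> pieces d" using c(1) r by (auto simp: consistent_def levels_ok_def)
    then have "j - 1 \<in> pieces d" using pieces_le[OF j, of "j - 1"] jk piecesD[OF k(1)] by simp
    then have "x k \<le> x (j - 1)" using jk by (intro x_mono) auto
    then have "ereal t \<le> ereal (X (j - 1))" using order_trans[OF k(2)] x_prev[OF j] by metis
    then have "f t \<le> f (X (j - 1))" using f_mono assms(1) by simp
    also have "\<dots> \<le> request_cost (now c) r (stat c r)" by (simp add: request_cost_def r)
    also have "\<dots> \<le> alg_cost c"
      unfolding alg_cost_def using r(1) request_cost_nonneg[OF c(1)] by (intro member_le_sum) auto
    finally show False using assms c by simp
  qed
  then show ?thesis by blast
qed

text \<open>For levels between 1 and \<open>J\<close> the truncated subtraction stays positive, so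
  moves, matches and arrivals all strictly lower the weight.\<close>

definition weight :: "nat \<Rightarrow> status \<Rightarrow> nat" where
  "weight J s = (case s of Unarrived \<Rightarrow> J + 2 | Waiting j \<Rightarrow> J + 1 - j | Matched q t \<Rightarrow> 0)"

definition idle :: "config \<Rightarrow> bool" where
  "idle c \<longleftrightarrow> (\<nexists>s k. full d x \<alpha> c s k) \<and> (\<forall>r\<in>R. stat c r = Unarrived \<longrightarrow> now c < arrival I r)"

text \<open>Rule \<open>wait\<close> changes no status, but it ends at an instant where something is
  due, so it clears the \<open>idle\<close> bit. Doubling the weights lets every other step absorb a
  newly set bit.\<close>

definition remaining :: "nat \<Rightarrow> config \<Rightarrow> nat" where
  "remaining J c = 2 * (\<Sum>r\<in>R. weight J (stat c r)) + (if idle c then 1 else 0)"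

lemma remaining_step:
  assumes step: "bpsla_step d x \<alpha> I c c'"
    and lev: "\<And>r j. r \<in> R \<Longrightarrow> stat c r = Waiting j \<Longrightarrow> j \<le> J"
    and lev': "\<And>r j. r \<in> R \<Longrightarrow> stat c' r = Waiting j \<Longrightarrow> j \<le> J"
  shows "remaining J c' < remaining J c"
proof -
  have less: ?thesis
    if "\<And>r. r \<in> R \<Longrightarrow> weight J (stat c' r) \<le> weight J (stat c r)"
      "p \<in> R" "weight J (stat c' p) < weight J (stat c p)" for p
  proof -
    have "(\<Sum>r\<in>R. weight J (stat c' r)) < (\<Sum>r\<in>R. weight J (stat c r))"
      using that by (intro sum_strict_mono_ex1) auto
    then show ?thesis by (simp add: remaining_def)
  qed
  show ?thesis
    using step
  proof cases
    case (match p k q)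
    then have "p \<in> R" "stat c p = Waiting k" by (auto simp: waiting_def)
    then show ?thesis using lev[of p k] match by (intro less[of p]) (auto simp: weight_def)
  next
    case (move s k r)
    then have r: "r \<in> R" "stat c r = Waiting k" "stat c' r = Waiting (Suc k)" by (auto simp: waiting_def)
    have "Suc k \<le> J" by (rule lev'[OF r(1,3)])
    then show ?thesis using r move by (intro less[of r]) (auto simp: weight_def)
  next
    case (arrive r)
    then show ?thesis by (intro less[of r]) (auto simp: weight_def)
  next
    case (wait \<delta>)
    then have "idle c" by (force simp: idle_def)
    moreover have "\<not> idle c'" using wait by (auto simp: idle_def) (auto simp: elapse_def)
    moreover have "stat c' = stat c" using wait by (simp add: elapse_def)
    ultimately show ?thesis by (simp add: remaining_def)
  qed
qed

text \<open>The cost bound holds along the whole run, so one \<open>J\<close> bounds all levels ever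
  used and \<open>remaining J\<close> is a decreasing measure.\<close>

lemma run_stops:
  assumes run: "bpsla_run d x \<alpha> I run" and unbounded: "\<And>B. \<exists>t\<ge>0. B < f t"
  obtains n where "\<nexists>c. bpsla_step d x \<alpha> I (run n) c"
proof (rule ccontr)
  assume "\<not> thesis"
  then have step: "bpsla_step d x \<alpha> I (run n) (run (Suc n))" for n
    using run that unfolding bpsla_run_def by blast
  obtain t where "0 \<le> t" "46 * (\<Sum>r\<in>R. f (gap r)) < f t" using unbounded by blast
  from levels_bounded[OF this] obtain J where "\<forall>c r j. consistent c \<longrightarrow>
      alg_cost c \<le> 46 * (\<Sum>r\<in>R. f (gap r)) \<longrightarrow> r \<in> R \<longrightarrow> stat c r = Waiting j \<longrightarrow> j \<le> J" ..
  then have "j \<le> J" if "r \<in> R" "stat (run n) r = Waiting j" for n r j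
    using run_consistent[OF run] run_alg_cost[OF run] that by blast
  then have dec: "remaining J (run (Suc n)) < remaining J (run n)" for n
    using remaining_step[OF step] by blast
  have "remaining J (run n) + n \<le> remaining J (run 0)" for n
  proof (induction n)
    case (Suc n)
    then show ?case using dec[of n] by linarith
  qed simp
  from this[of "Suc (remaining J (run 0))"] show False by simp
qed

section \<open>A stopped run has matched everything\<close>

lemma progress:
  assumes c: "consistent c" and stuck: "\<nexists>c'. bpsla_step d x \<alpha> I c c'" and r: "r \<in> R"
  shows "\<exists>q t. stat c r = Matched q t"
proof -
  have nm: "\<not> match_pending I c"
    using stuck bpsla_step.match[of _ I c] unfolding match_pending_def by blast
  have nf: "\<nexists>s k. full d x \<alpha> c s k"
  proof
    assume "\<exists>s k. full d x \<alpha> c s k"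
    then obtain s k where k: "full d x \<alpha> c s k" by blast
    then have "waiting I c s k \<noteq> {}"
      using c waiting_net by (auto simp: consistent_def full_ok_def)
    then show False using stuck bpsla_step.move[OF nm k] by blast
  qed
  have ahead: "now c < arrival I q" if q: "q \<in> R" "stat c q = Unarrived" for q
  proof -
    have "now c \<le> arrival I q" using c q by (simp add: consistent_def timely_def)
    moreover have "arrival I q \<noteq> now c" using stuck bpsla_step.arrive[OF nm nf q] by blast
    ultimately show ?thesis by simp
  qed
  define U where "U = {q \<in> R. stat c q = Unarrived}"
  define A where "A = {(s, k). k \<in> pieces d \<and> d \<noteq> enat k \<and> rate \<alpha> I c s k \<noteq> 0}"
  define next_full where "next_full = (\<lambda>(s, k). (Y k - counter c s k) / rate \<alpha> I c s k)"
  \<comment> \<open>The times until the next arrival or the next overflow of a bounded rising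
    counter. If there are any, the least of them is a legal \<open>\<delta>\<close> for rule
    \<open>wait\<close>.\<close>
  define T where "T = (\<lambda>q. arrival I q - now c) ` U \<union> next_full ` A"
  \<comment> \<open>A rising counter has a waiting request, whose polarity and level identify
    it.\<close>
  have "A \<subseteq> (\<lambda>q. (polarity I q, case stat c q of Waiting k \<Rightarrow> k | _ \<Rightarrow> 0)) ` R"
    by (force simp: A_def rate_eq waiting_def split: if_splits)
  then have "finite A" by (rule finite_subset) simp
  then have finT: "finite T" by (simp add: T_def U_def)
  have room: "counter c s k < Y k \<and> 0 < rate \<alpha> I c s k" if "(s, k) \<in> A" for s k
  proof -
    have k: "k \<in> pieces d" "d \<noteq> enat k" "rate \<alpha> I c s k \<noteq> 0" using that by (auto simp: A_def)
    have "\<not> full d x \<alpha> c s k" using nf by blast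
    then have "counter c s k \<noteq> Y k" using capacity_finite[OF k(1,2)] k by (auto simp: full_def)
    then show ?thesis using counter_bounds(2)[OF c k(1,2), of s] rate_nonneg[OF k(1), of c s] k(3) by simp
  qed
  have "T = {}"
  proof (rule ccontr)
    assume ne: "T \<noteq> {}"
    define \<delta> where "\<delta> = Min T"
    have \<delta>: "\<delta> \<in> T" "\<And>t. t \<in> T \<Longrightarrow> \<delta> \<le> t" using finT ne by (auto simp: \<delta>_def)
    have pos: "0 < \<delta>" using \<delta>(1) ahead room by (auto simp: T_def U_def next_full_def)
    have early: "\<forall>q\<in>R. stat c q = Unarrived \<longrightarrow> now c + \<delta> \<le> arrival I q"
    proof (intro ballI impI)
      fix q assume "q \<in> R" "stat c q = Unarrived"
      then have "\<delta> \<le> arrival I q - now c" by (intro \<delta>(2)) (auto simp: T_def U_def)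
      then show "now c + \<delta> \<le> arrival I q" by simp
    qed
    have fits: "\<forall>s. \<forall>k\<in>pieces d. ereal (counter (elapse \<alpha> I \<delta> c) s k) \<le> capacity x \<alpha> k"
    proof (intro allI ballI)
      fix s k assume k: "k \<in> pieces d"
      show "ereal (counter (elapse \<alpha> I \<delta> c) s k) \<le> capacity x \<alpha> k"
      proof (cases "(s, k) \<in> A")
        case True
        then have "\<delta> \<le> (Y k - counter c s k) / rate \<alpha> I c s k"
          by (intro \<delta>(2)) (force simp: T_def next_full_def)
        then have "\<delta> * rate \<alpha> I c s k \<le> Y k - counter c s k"
          using room[OF True] by (simp add: pos_le_divide_eq)
        then show ?thesis using capacity_finite[OF k] True by (simp add: elapse_def A_def)
      next
        case False
        then show ?thesis
          using c k capacity_last[OF k] by (cases "d = enat k") (auto simp: A_def elapse_def consistent_def counters_ok_def)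
      qed
    qed
    have "(\<exists>s k. full d x \<alpha> (elapse \<alpha> I \<delta> c) s k) \<or>
      (\<exists>q\<in>R. stat c q = Unarrived \<and> arrival I q = now c + \<delta>)"
    proof -
      consider q where "q \<in> U" "\<delta> = arrival I q - now c" | s k where "(s, k) \<in> A" "\<delta> = next_full (s, k)"
        using \<delta>(1) by (auto simp: T_def)
      then show ?thesis
      proof cases
        case 1
        then show ?thesis by (auto simp: U_def)
      next
        case 2
        then have "counter (elapse \<alpha> I \<delta> c) s k = Y k"
          using room[OF 2(1)] by (simp add: elapse_def next_full_def)
        then have "full d x \<alpha> (elapse \<alpha> I \<delta> c) s k"
          using 2(1) capacity_finite[of k] by (simp add: full_def A_def)
        then show ?thesis by blast
      qed
    qed
    then show False using stuck bpsla_step.wait[OF nm nf pos early fits] by blast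
  qed
  then have "A = {}" and all: "\<And>q. q \<in> R \<Longrightarrow> stat c q \<noteq> Unarrived" by (auto simp: T_def U_def)
  show ?thesis
  proof (rule ccontr)
    assume "\<not> ?thesis"
    then have ex: "\<exists>k. \<exists>q\<in>R. stat c q = Waiting k" using all[OF r] r by (metis status.exhaust)
    \<comment> \<open>At the lowest occupied level the surplus equals the net and is nonzero, so a
      counter rises there. As no bounded counter rises, this level is the last one. All its requests
      count in the target, which then vanishes because every pair has arrived.\<close>
    define k where "k = (LEAST k. \<exists>q\<in>R. stat c q = Waiting k)"
    obtain q where q: "q \<in> R" "stat c q = Waiting k" using LeastI_ex[OF ex] by (auto simp: k_def)
    have k: "k \<in> pieces d" using c q by (auto simp: consistent_def levels_ok_def)
    have below: "net c i = 0" if "i < k" for i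
      using not_less_Least[of i "\<lambda>k. \<exists>q\<in>R. stat c q = Waiting k"] that
      unfolding net_def k_def by (intro sum.neutral) auto
    have sur: "surplus c k = net c k"
    proof -
      have "surplus c k = (\<Sum>i=1..k - 1. net c i) + net c k"
        using piecesD[OF k] unfolding surplus_def by (cases k) auto
      also have "(\<Sum>i=1..k - 1. net c i) = 0"
        using below piecesD[OF k] by (intro sum.neutral) auto
      finally show ?thesis by simp
    qed
    have "waiting I c (polarity I q) k \<noteq> {}" using q by (auto simp: waiting_def)
    moreover from net_waiting(2)[OF nm this] have pos: "0 < psign (polarity I q) * surplus c k" using sur by simp
    ultimately have "rate \<alpha> I c (polarity I q) k \<noteq> 0" using slope_pos[OF k] by (auto simp: rate_eq)
    then have d: "d = enat k" using k \<open>A = {}\<close> by (auto simp: A_def)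
    then have "surplus c k = target c k"
      using c unfolding consistent_def last_ok_def offset_def by simp
    also have "\<dots> = (\<Sum>q\<in>R. sg q)"
      unfolding target_def using all x_infinite_iff[OF k] d by (intro sum.cong) auto
    also have "\<dots> = 0" using \<pi>_polarity polarity_neq by (intro sum_closed_eq_0) auto
    finally show False using pos by simp
  qed
qed

text \<open>The solution is read off a configuration without successor. There every charge is the
  delay cost of a matched request, so \<open>alg_cost\<close> is the cost of
  \<open>S\<close>.\<close>

lemma produces_solution:
  assumes run: "bpsla_run d x \<alpha> I run" and unbounded: "\<And>B. \<exists>t\<ge>0. B < f t"
  obtains S where "produces I run S" "feasible I S" "cost f I S \<le> 46 * (\<Sum>r\<in>R. f (gap r))"
proof -
  obtain n where stuck: "\<nexists>c. bpsla_step d x \<alpha> I (run n) c"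
    using run_stops[OF run unbounded] by blast
  define c where "c = run n"
  have c: "consistent c" unfolding c_def by (rule run_consistent[OF run])
  define S where "S = \<lparr>partner = (\<lambda>r. case stat c r of Matched q t \<Rightarrow> q | _ \<Rightarrow> r),
    match_time = (\<lambda>r. case stat c r of Matched q t \<Rightarrow> t | _ \<Rightarrow> 0)\<rparr>"
  have S: "stat c r = Matched (partner S r) (match_time S r)" if "r \<in> R" for r
    using progress[OF c] stuck that by (force simp: c_def S_def)
  have "produces I run S" using S by (auto simp: produces_def c_def)
  moreover have "feasible I S"
    unfolding feasible_def
  proof (intro ballI)
    fix r assume r: "r \<in> R"
    let ?q = "partner S r"
    have q: "?q \<in> R \<and> polarity I ?q \<noteq> polarity I r \<and> stat c ?q = Matched r (match_time S r) \<and>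
        arrival I r \<le> match_time S r"
      using c r S[OF r] unfolding consistent_def matching_ok_def by blast
    then show "?q \<in> R \<and> polarity I ?q \<noteq> polarity I r \<and> partner S ?q = r \<and>
        match_time S ?q = match_time S r \<and> arrival I r \<le> match_time S r"
      using S[of ?q] by simp
  qed
  moreover have "cost f I S = alg_cost c"
    unfolding cost_def alg_cost_def by (intro sum.cong) (auto simp: S request_cost_def)
  then have "cost f I S \<le> 46 * (\<Sum>r\<in>R. f (gap r))" using run_alg_cost[OF run, of n] by (simp add: c_def)
  ultimately show ?thesis by (rule that)
qed

text \<open>Partners are matched at a common time after both arrivals, so the earlier one waits at
  least the gap. Adding the costs of both partners counts each request twice.\<close>

lemma gap_cost_le:
  assumes S: "feasible I S" and \<pi>: "\<pi> = partner S"
  shows "(\<Sum>r\<in>R. f (gap r)) \<le> 2 * cost f I S"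
proof -
  let ?g = "\<lambda>r. f (match_time S r - arrival I r)"
  have "(\<Sum>r\<in>R. f (gap r)) \<le> (\<Sum>r\<in>R. ?g r + ?g (\<pi> r))"
  proof (intro sum_mono)
    fix r assume r: "r \<in> R"
    have "arrival I q \<le> match_time S q" if "q \<in> R" for q using S that by (simp add: feasible_def)
    from this[OF r] this[OF \<pi>_in[OF r]]
    have m: "arrival I r \<le> match_time S r" "arrival I (\<pi> r) \<le> match_time S (\<pi> r)"
      "match_time S (\<pi> r) = match_time S r"
      using S r by (auto simp: feasible_def \<pi>)
    have "f (gap r) \<le> ?g r \<or> f (gap r) \<le> ?g (\<pi> r)"
      using m f_mono[OF gap_nonneg, of r] by (cases "arrival I r \<le> arrival I (\<pi> r)") (auto simp: gap_def)
    moreover have "0 \<le> ?g r" "0 \<le> ?g (\<pi> r)" using m f_nonneg by auto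
    ultimately show "f (gap r) \<le> ?g r + ?g (\<pi> r)" by linarith
  qed
  then show ?thesis by (simp add: sum.distrib sum_\<pi>[of ?g] cost_def)
qed

end

section \<open>The competitive ratio\<close>

theorem theorem22:
  shows "\<exists>C::real. \<forall>D f d x \<alpha> I run Opt.
     admissible D \<longrightarrow>
     exp_decreasing_pl f d x \<alpha> \<longrightarrow>
     (\<forall>t\<ge>0. f t \<le> D t \<and> D t \<le> 2 * f t) \<longrightarrow>
     valid_instance I \<longrightarrow>
     bpsla_run d x \<alpha> I run \<longrightarrow>
     optimal D I Opt \<longrightarrow>
     (\<exists>S. produces I run S \<and> feasible I S \<and> cost D I S \<le> C * cost D I Opt)"
proof (intro exI[of _ 184] allI impI)
  fix D f d x \<alpha> I run Opt
  assume D: "admissible D" and pl: "exp_decreasing_pl f d x \<alpha>"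
    and fD: "\<forall>t\<ge>0. f t \<le> D t \<and> D t \<le> 2 * f t"
    and I: "valid_instance I" and run: "bpsla_run d x \<alpha> I run" and opt: "optimal D I Opt"
  have Opt: "feasible I Opt" using opt by (simp add: optimal_def)
  interpret bpsla f d x \<alpha> I "partner Opt"
    by unfold_locales (use pl I Opt in \<open>auto simp: feasible_def\<close>)
  \<comment> \<open>\<open>D\<close> tends to infinity and is at most \<open>2 * f\<close>, so
    \<open>f\<close> is unbounded, as the termination argument requires.\<close>
  have unbounded: "\<exists>t\<ge>0. B < f t" for B
  proof -
    have "eventually (\<lambda>t. 2 * B < D t) at_top"
      using D by (simp add: admissible_def filterlim_at_top_dense)
    then have "eventually (\<lambda>t. 2 * B < D t \<and> 0 \<le> t) at_top"
      using eventually_ge_at_top[of 0] by (rule eventually_conj)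
    then obtain t where "2 * B < D t" "0 \<le> t" by (auto simp: eventually_at_top_linorder)
    then show ?thesis using fD by (intro exI[of _ t]) force
  qed
  obtain S where S: "produces I run S" "feasible I S" and
    le: "cost f I S \<le> 46 * (\<Sum>r\<in>requests I. f (gap r))"
    by (rule produces_solution[OF run unbounded])
  \<comment> \<open>The constant 184 is 2 * 46 * 2: passing from \<open>D\<close> to
    \<open>f\<close>, the amortised bound, and the passage from gaps to the optimal cost.\<close>
  have "cost D I S \<le> 2 * cost f I S"
    unfolding cost_def sum_distrib_left using S(2) fD
    by (intro sum_mono) (auto simp: feasible_def)
  also have "\<dots> \<le> 2 * (46 * (\<Sum>r\<in>requests I. f (gap r)))" using le by simp
  also have "\<dots> \<le> 2 * (46 * (2 * cost f I Opt))" using gap_cost_le[OF Opt refl] by simp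
  also have "\<dots> = 184 * cost f I Opt" by simp
  also have "\<dots> \<le> 184 * cost D I Opt"
    unfolding cost_def using Opt fD by (intro mult_left_mono sum_mono) (auto simp: feasible_def)
  finally show "\<exists>S. produces I run S \<and> feasible I S \<and> cost D I S \<le> 184 * cost D I Opt"
    using S by blast
qed

end
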